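(* Assume (CVX), (SM), (BV), (QSM) and (SCO). Let $L_{\max}=\max_iL_i$, $\kappa=\ell/\mu$, $q=L_{\max}/\sqrt{\ell\mu}$, $\sigma^2=\sum_i\sigma_i^2$, and run PEARL-SGD with step-sizes, for $\tau p\le k\le\tau(p+1)-1$ and $p=0,\dots,R-1$, $$\gamma_k=\begin{cases}\frac{1}{\ell\tau(1+2q)} & \text{if } p<2(1+2q)\kappa,\\ \frac{1}{\tau\mu}\frac{2p+1}{(p+1)^2} & \text{if } p\ge2(1+2q)\kappa.\end{cases}$$ Then, with $T=\tau R$, $$\mathbb{E}\|\mathbf{x}_T-\mathbf{x}_\star\|^2\le\frac{4(1+2q)^2\kappa^2\tau^2\|\mathbf{x}_0-\mathbf{x}_\star\|^2}{eT^2}+\frac{4(1+q)\sigma^2}{\mu^2T}+\frac{4(1+2q)^2\kappa\tau\sigma^2}{\mu^2T^2}\Big(1+\frac{2\tau}{\sqrt\kappa}\Big)+\frac{32(1+q)\tau^2L_{\max}\sigma^2\log T}{\mu^3T^2}.$$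
   Context: Setup. Let $n\ge1$, $D=d_1+\dots+d_n$, joint action $\mathbf{x}=(x^1,\dots,x^n)\in\mathbb{R}^D$, $x^i\in\mathbb{R}^{d_i}$, $x^{-i}$ all blocks except the $i$-th, $f_i(x^i;x^{-i})=f_i(\mathbf{x})$. For each $i$, $f_i(\mathbf{x})=\mathbb{E}_{\xi\sim\mathcal{D}_i}[f_{i,\xi}(\mathbf{x})]$; $\nabla f_i(x^i;x^{-i})$, $\nabla f_{i,\xi}(x^i;x^{-i})$ are gradients in $x^i$ only, with $\mathbb{E}_{\xi\sim\mathcal{D}_i}[\nabla f_{i,\xi}(x^i;x^{-i})]=\nabla f_i(x^i;x^{-i})$. $\mathbb{F}(\mathbf{x})=(\nabla f_1(x^1;x^{-1}),\dots,\nabla f_n(x^n;x^{-n}))$. Assumptions. (CVX): each $f_i(\cdot;x^{-i})$ convex. (SM): $\|\nabla f_i(x^i;x^{-i})-\nabla f_i(y^i;x^{-i})\|\le L_i\|x^i-y^i\|$. (BV): $\mathbb{E}_{\xi\sim\mathcal{D}_i}\|\nabla f_{i,\xi}(x^i;x^{-i})-\nabla f_i(x^i;x^{-i})\|^2\le\sigma_i^2$. (QSM): unique $\mathbf{x}_\star$ with $\mathbb{F}(\mathbf{x}_\star)=0$, and $\langle\mathbb{F}(\mathbf{x}),\mathbf{x}-\mathbf{x}_\star\rangle\ge\mu\|\mathbf{x}-\mathbf{x}_\star\|^2$ for all $\mathbf{x}$ ($\mu>0$). (SCO): $\langle\mathbb{F}(\mathbf{x}),\mathbf{x}-\mathbf{x}_\star\rangle\ge\frac1\ell\|\mathbb{F}(\mathbf{x})\|^2$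 for all $\mathbf{x}$ ($\ell>0$). PEARL-SGD: given deterministic $\mathbf{x}_0$, $\tau\ge1$, $R\ge1$, step-sizes $\gamma_k>0$: for $p=0,\dots,R-1$, each $i$, $k=\tau p,\dots,\tau(p+1)-1$, draw $\xi^i_k\sim\mathcal{D}_i$ independently of the past and set $x^i_{k+1}=x^i_k-\gamma_k\nabla f_{i,\xi^i_k}(x^i_k;x^{-i}_{\tau p})$; $\mathbf{x}_k=(x^1_k,\dots,x^n_k)$. *)

theory Defs
  imports "HOL-Probability.Probability"
begin

text \<open>The joint action space R^D is an abstract Euclidean space 'a whose basis is
partitioned into blocks B 0, ..., B (n-1); block i spans a copy of R^{d_i}, d_i = card (B i).
Block vectors x^i are represented as elements of span (B i).\<close>

definition blkproj :: "'a::euclidean_space set \<Rightarrow> 'a \<Rightarrow> 'a" where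
  "blkproj Bi x = (\<Sum>b\<in>Bi. (x \<bullet> b) *\<^sub>R b)"

definition with_block :: "'a::euclidean_space set \<Rightarrow> 'a \<Rightarrow> 'a \<Rightarrow> 'a" where
  "with_block Bi x y = x - blkproj Bi x + y"

text \<open>Local steps of round p of PEARL-SGD starting at the anchor a = x_{tau p};
g i s x is the stochastic block gradient of player i at x for sample s;
xi i k is the sample drawn by player i at step k.\<close>
primrec pearl_local :: "nat \<Rightarrow> (nat \<Rightarrow> 'a::euclidean_space set) \<Rightarrow> (nat \<Rightarrow> 'b \<Rightarrow> 'a \<Rightarrow> 'a)
    \<Rightarrow> (nat \<Rightarrow> real) \<Rightarrow> nat \<Rightarrow> (nat \<Rightarrow> nat \<Rightarrow> 'b) \<Rightarrow> 'a \<Rightarrow> nat \<Rightarrow> nat \<Rightarrow> 'a" where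
  "pearl_local n B g \<gamma> \<tau> xi a p 0 = a"
| "pearl_local n B g \<gamma> \<tau> xi a p (Suc m) =
     (let y = pearl_local n B g \<gamma> \<tau> xi a p m; k = \<tau> * p + m
      in y - \<gamma> k *\<^sub>R (\<Sum>i<n. g i (xi i k) (with_block (B i) a (blkproj (B i) y))))"

primrec pearl_anchor :: "nat \<Rightarrow> (nat \<Rightarrow> 'a::euclidean_space set) \<Rightarrow> (nat \<Rightarrow> 'b \<Rightarrow> 'a \<Rightarrow> 'a)
    \<Rightarrow> (nat \<Rightarrow> real) \<Rightarrow> nat \<Rightarrow> (nat \<Rightarrow> nat \<Rightarrow> 'b) \<Rightarrow> 'a \<Rightarrow> nat \<Rightarrow> 'a" where
  "pearl_anchor n B g \<gamma> \<tau> xi x0 0 = x0"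
| "pearl_anchor n B g \<gamma> \<tau> xi x0 (Suc p) =
     pearl_local n B g \<gamma> \<tau> xi (pearl_anchor n B g \<gamma> \<tau> xi x0 p) p \<tau>"

definition pearl_iter :: "nat \<Rightarrow> (nat \<Rightarrow> 'a::euclidean_space set) \<Rightarrow> (nat \<Rightarrow> 'b \<Rightarrow> 'a \<Rightarrow> 'a)
    \<Rightarrow> (nat \<Rightarrow> real) \<Rightarrow> nat \<Rightarrow> (nat \<Rightarrow> nat \<Rightarrow> 'b) \<Rightarrow> 'a \<Rightarrow> nat \<Rightarrow> 'a" where
  "pearl_iter n B g \<gamma> \<tau> xi x0 k =
     pearl_local n B g \<gamma> \<tau> xi (pearl_anchor n B g \<gamma> \<tau> xi x0 (k div \<tau>)) (k div \<tau>) (k mod \<tau>)"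

end

theory Submission
  imports Defs
begin

text \<open>
With the anchor \<open>a = x_{\<tau> p}\<close> frozen, the local steps follow the field \<open>y \<mapsto> (\<nabla>f_i(y^i; a^{-i}))_i\<close>,
the gradient of a single convex \<open>L_max\<close>-smooth function. It is therefore cocoercive and its
gradient steps are nonexpansive. Compare the noisy iterates \<open>y_m\<close> with the noiseless iterates \<open>z_m\<close>
from the same anchor, and put \<open>c = \<tau>\<gamma>\<close>. QSM and SCO give
\<open>|z_\<tau> - x_*|^2 \<le> (1 - c\<mu>(1 + q/(1+2q))) |a - x_*|^2\<close>. By nonexpansiveness \<open>E|y_m - z_m|^2\<close> grows by at
most \<open>\<gamma>^2\<sigma>^2\<close> per step, and the bias \<open>E<z_\<tau> - x_*, y_\<tau> - z_\<tau>>\<close> is absorbed by the surplus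
\<open>q/(1+2q)\<close> of the contraction, so that
\<open>E|x_{\<tau>(p+1)} - x_*|^2 \<le> (1 - c\<mu>) E|x_{\<tau> p} - x_*|^2 + (1+q)\<gamma>^2\<tau>\<sigma>^2\<close>.
Once \<open>c\<mu> = (2p+1)/(p+1)^2\<close>, multiplying by \<open>(p+1)^2\<close> makes this recursion telescope. The logarithmic
term of the bound enters only through its nonnegativity.
\<close>

subsection \<open>Gradient steps of convex smooth functions\<close>

lemma has_derivative_along_line:
  fixes \<Phi> :: "'a::real_inner \<Rightarrow> real"
  assumes "\<And>x. (\<Phi> has_derivative (\<lambda>h. g x \<bullet> h)) (at x)"
  shows "((\<lambda>t. \<Phi> (x + t *\<^sub>R v)) has_real_derivative (g (x + t *\<^sub>R v) \<bullet> v)) (at t)"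
proof -
  have "((\<lambda>t. x + t *\<^sub>R v) has_derivative (\<lambda>h. h *\<^sub>R v)) (at t)"
    by (auto intro!: derivative_eq_intros)
  from has_derivative_compose[OF this assms]
  have "((\<lambda>t. \<Phi> (x + t *\<^sub>R v)) has_derivative (\<lambda>h. g (x + t *\<^sub>R v) \<bullet> (h *\<^sub>R v))) (at t)" .
  then show ?thesis
    by (simp add: has_field_derivative_def mult_commute_abs)
qed

text \<open>Restriction to the line through \<open>x\<close> and \<open>y\<close> reduces this to
  the tangent inequality for convex functions of one real variable.\<close>

lemma convex_gradient_lower_bound:
  fixes \<Phi> :: "'a::real_inner \<Rightarrow> real"
  assumes cvx: "convex_on UNIV \<Phi>"
    and der: "\<And>x. (\<Phi> has_derivative (\<lambda>h. g x \<bullet> h)) (at x)"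
  shows "\<Phi> x + g x \<bullet> (y - x) \<le> \<Phi> y"
proof -
  let ?\<psi> = "\<lambda>t. \<Phi> (x + t *\<^sub>R (y - x))"
  have "convex_on UNIV ?\<psi>"
  proof (rule convex_onI)
    fix t u v :: real assume t: "0 < t" "t < 1"
    have "x + ((1 - t) * u + t * v) *\<^sub>R (y - x)
        = (1 - t) *\<^sub>R (x + u *\<^sub>R (y - x)) + t *\<^sub>R (x + v *\<^sub>R (y - x))"
      by (simp add: algebra_simps)
    then show "?\<psi> ((1 - t) *\<^sub>R u + t *\<^sub>R v) \<le> (1 - t) * ?\<psi> u + t * ?\<psi> v"
      using convex_onD[OF cvx, of t "x + u *\<^sub>R (y - x)" "x + v *\<^sub>R (y - x)"] t by simp
  qed simp
  moreover have "(?\<psi> has_real_derivative (g x \<bullet> (y - x))) (at 0)"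
    using has_derivative_along_line[OF der, of x "y - x" 0] by simp
  ultimately have "?\<psi> 1 - ?\<psi> 0 \<ge> (g x \<bullet> (y - x)) * (1 - 0)"
    by (intro convex_on_imp_above_tangent[where A=UNIV]) auto
  then show ?thesis by simp
qed

text \<open>Descent lemma: along \<open>x + t *\<^sub>R v\<close>, \<open>\<Phi>\<close> minus its
  quadratic upper model has nonpositive derivative on [0, 1], by Cauchy-Schwarz and the Lipschitz
  bound.\<close>

lemma smooth_gradient_upper_bound:
  fixes \<Phi> :: "'a::real_inner \<Rightarrow> real"
  assumes der: "\<And>x. (\<Phi> has_derivative (\<lambda>h. g x \<bullet> h)) (at x)"
    and lip: "\<And>x y. norm (g x - g y) \<le> L * norm (x - y)"
  shows "\<Phi> (x + v) \<le> \<Phi> x + g x \<bullet> v + L / 2 * (norm v)\<^sup>2"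
proof -
  let ?\<psi> = "\<lambda>t. \<Phi> (x + t *\<^sub>R v) - t * (g x \<bullet> v) - t\<^sup>2 * (L / 2 * (norm v)\<^sup>2)"
  have "?\<psi> 1 \<le> ?\<psi> 0"
  proof (rule DERIV_nonpos_imp_nonincreasing[where f="?\<psi>"])
    fix t :: real assume t: "0 \<le> t" "t \<le> 1"
    let ?d = "g (x + t *\<^sub>R v) \<bullet> v - g x \<bullet> v - 2 * t * (L / 2 * (norm v)\<^sup>2)"
    have "(?\<psi> has_real_derivative ?d) (at t)"
      by (auto intro!: derivative_eq_intros has_derivative_along_line[OF der])
    moreover have "?d \<le> 0"
    proof -
      have "(g (x + t *\<^sub>R v) - g x) \<bullet> v \<le> norm (g (x + t *\<^sub>R v) - g x) * norm v"
        by (rule norm_cauchy_schwarz)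
      also have "\<dots> \<le> (L * norm ((x + t *\<^sub>R v) - x)) * norm v"
        by (intro mult_right_mono lip) auto
      also have "\<dots> = 2 * t * (L / 2 * (norm v)\<^sup>2)"
        using t by (simp add: power2_eq_square)
      finally show ?thesis by (simp add: inner_diff_left)
    qed
    ultimately show "\<exists>y. (?\<psi> has_real_derivative y) (at t) \<and> y \<le> 0" by blast
  qed simp
  then show ?thesis by simp
qed

text \<open>Baillon--Haddad: apply the descent lemma to \<open>\<Phi> - g x \<bullet> _\<close>, which is minimal at \<open>x\<close>.\<close>

lemma convex_smooth_gradient_cocoercive:
  fixes \<Phi> :: "'a::real_inner \<Rightarrow> real"
  assumes cvx: "convex_on UNIV \<Phi>"
    and der: "\<And>x. (\<Phi> has_derivative (\<lambda>h. g x \<bullet> h)) (at x)"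
    and lip: "\<And>x y. norm (g x - g y) \<le> L * norm (x - y)"
    and L: "0 \<le> L"
  shows "(norm (g x - g y))\<^sup>2 \<le> L * ((g x - g y) \<bullet> (x - y))"
proof (cases "L = 0")
  case True
  then show ?thesis using lip[of x y] by simp
next
  case False
  with L have L: "0 < L" by simp
  have half: "\<Phi> x + g x \<bullet> (y - x) + (norm (g y - g x))\<^sup>2 / (2 * L) \<le> \<Phi> y" for x y
  proof -
    \<comment> \<open>This \<open>v\<close> minimises the upper bound
      \<open>d \<bullet> v + L / 2 * (norm v)\<^sup>2\<close>; the minimum is
      \<open>- (norm d)\<^sup>2 / (2 * L)\<close>.\<close>
    define d v where "d = g y - g x" and "v = - (1 / L) *\<^sub>R d"
    have "\<Phi> x + g x \<bullet> (y + v - x) \<le> \<Phi> (y + v)"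
      by (rule convex_gradient_lower_bound[OF cvx der])
    also have "\<dots> \<le> \<Phi> y + g y \<bullet> v + L / 2 * (norm v)\<^sup>2"
      by (rule smooth_gradient_upper_bound[OF der lip])
    finally have "\<Phi> x + g x \<bullet> (y - x) \<le> \<Phi> y + d \<bullet> v + L / 2 * (norm v)\<^sup>2"
      by (simp add: d_def inner_diff_left inner_diff_right inner_add_right)
    moreover have "d \<bullet> v = - ((norm d)\<^sup>2 / L)"
      by (simp add: v_def power2_norm_eq_inner)
    moreover have "L / 2 * (norm v)\<^sup>2 = (norm d)\<^sup>2 / L / 2"
      using L by (simp add: v_def power2_eq_square)
    moreover have "(norm d)\<^sup>2 / (2 * L) = (norm d)\<^sup>2 / L / 2" by simp
    ultimately have "\<Phi> x + g x \<bullet> (y - x) \<le> \<Phi> y + - ((norm d)\<^sup>2 / L) + (norm d)\<^sup>2 / L / 2"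
      by (simp only:)
    then show ?thesis by (simp add: d_def)
  qed
  \<comment> \<open>Adding \<open>half\<close> for the pairs (x, y) and (y, x) cancels the function
    values.\<close>
  have "(norm (g x - g y))\<^sup>2 / L \<le> (g x - g y) \<bullet> (x - y)"
  proof -
    have "g x \<bullet> (y - x) + g y \<bullet> (x - y) = - ((g x - g y) \<bullet> (x - y))"
      by (simp add: inner_diff_left inner_diff_right)
    moreover have "(norm (g x - g y))\<^sup>2 / (2 * L) = (norm (g x - g y))\<^sup>2 / L / 2" by simp
    ultimately show ?thesis
      using half[of x y] half[of y x] by (simp add: norm_minus_commute[of "g y"])
  qed
  then show ?thesis using L by (simp add: pos_divide_le_eq mult.commute)
qed

text \<open>Cauchy-Schwarz on the right, then one factor cancels. Later lemmas can thus take
  cocoercivity as the single regularity condition on the field.\<close>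

lemma cocoercive_imp_lipschitz:
  fixes g :: "'a::real_inner \<Rightarrow> 'a"
  assumes "(norm (g x - g y))\<^sup>2 \<le> L * ((g x - g y) \<bullet> (x - y))" "0 \<le> L"
  shows "norm (g x - g y) \<le> L * norm (x - y)"
proof (cases "norm (g x - g y) = 0")
  case False
  have "norm (g x - g y) * norm (g x - g y) \<le> L * (norm (g x - g y) * norm (x - y))"
    using assms(1) mult_left_mono[OF norm_cauchy_schwarz[of "g x - g y" "x - y"] assms(2)]
    by (simp add: power2_eq_square)
  with False show ?thesis by (simp add: mult.left_commute)
qed (use assms in auto)

text \<open>Expanding the square, the claim follows from
  \<open>\<eta> * (norm ?e)\<^sup>2 \<le> 2 * (?e \<bullet> ?d)\<close>, which is cocoercivity
  combined with \<open>\<eta> * L \<le> 2\<close>.\<close>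

lemma cocoercive_gradient_step_nonexpansive:
  fixes g :: "'a::real_inner \<Rightarrow> 'a"
  assumes coco: "(norm (g x - g y))\<^sup>2 \<le> L * ((g x - g y) \<bullet> (x - y))"
    and \<eta>: "0 \<le> \<eta>" "\<eta> * L \<le> 2" and L: "0 \<le> L"
  shows "norm ((x - y) - \<eta> *\<^sub>R (g x - g y)) \<le> norm (x - y)"
proof -
  let ?d = "x - y" and ?e = "g x - g y"
  have "\<eta> * (norm ?e)\<^sup>2 \<le> 2 * (?e \<bullet> ?d)"
  \<comment> \<open>Multiplying \<open>\<eta> * L \<le> 2\<close> by the inner product needs its
    sign; a negative value would force \<open>?e = 0\<close> through cocoercivity.\<close>
  proof (cases "0 \<le> ?e \<bullet> ?d")
    case True
    have "\<eta> * (norm ?e)\<^sup>2 \<le> \<eta> * (L * (?e \<bullet> ?d))"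
      by (intro mult_left_mono coco \<eta>)
    also have "\<dots> \<le> 2 * (?e \<bullet> ?d)"
      using mult_right_mono[OF \<eta>(2) True] by (simp add: mult.assoc)
    finally show ?thesis .
  next
    case False
    then have "(norm ?e)\<^sup>2 \<le> 0"
      using order_trans[OF coco mult_nonneg_nonpos[OF L, of "?e \<bullet> ?d"]] by simp
    then have "?e = 0" by simp
    then show ?thesis by (simp only:) simp
  qed
  then have "\<eta> * (\<eta> * (norm ?e)\<^sup>2) \<le> \<eta> * (2 * (?e \<bullet> ?d))"
    using \<eta> by (intro mult_left_mono) auto
  moreover have "(norm (?d - \<eta> *\<^sub>R ?e))\<^sup>2
      = (norm ?d)\<^sup>2 - \<eta> * (2 * (?e \<bullet> ?d)) + \<eta> * (\<eta> * (norm ?e)\<^sup>2)"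
    by (simp only: power2_norm_eq_inner inner_diff_left inner_diff_right inner_scaleR_left
        inner_scaleR_right) (simp add: algebra_simps inner_commute)
  ultimately have "(norm (?d - \<eta> *\<^sub>R ?e))\<^sup>2 \<le> (norm ?d)\<^sup>2" by simp
  then show ?thesis by (rule power2_le_imp_le) simp
qed

primrec gd_iter :: "('a::real_vector \<Rightarrow> 'a) \<Rightarrow> real \<Rightarrow> 'a \<Rightarrow> nat \<Rightarrow> 'a" where
  "gd_iter g \<eta> a 0 = a"
| "gd_iter g \<eta> a (Suc m) = gd_iter g \<eta> a m - \<eta> *\<^sub>R g (gd_iter g \<eta> a m)"

context
  fixes g :: "'a::real_inner \<Rightarrow> 'a" and L \<eta> :: real
  assumes coco: "\<And>x y. (norm (g x - g y))\<^sup>2 \<le> L * ((g x - g y) \<bullet> (x - y))"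
    and L: "0 \<le> L" and \<eta>: "0 < \<eta>" "\<eta> * L \<le> 2"
begin

text \<open>The step map is nonexpansive. Applied to an iterate and its successor, whose difference
  is \<open>\<eta>\<close> times a gradient, it shows that gradient norms do not increase.\<close>

lemma gd_iter_gradient_le: "norm (g (gd_iter g \<eta> a m)) \<le> norm (g a)"
proof (induction m)
  case (Suc m)
  let ?z = "gd_iter g \<eta> a m"
  have "norm ((?z - \<eta> *\<^sub>R g ?z - ?z) - \<eta> *\<^sub>R (g (?z - \<eta> *\<^sub>R g ?z) - g ?z))
      \<le> norm (?z - \<eta> *\<^sub>R g ?z - ?z)"
    using \<eta> L by (intro cocoercive_gradient_step_nonexpansive[OF coco]) auto
  then have "\<eta> * norm (g (?z - \<eta> *\<^sub>R g ?z)) \<le> \<eta> * norm (g ?z)"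
    using \<eta> by (simp add: algebra_simps)
  then show ?case using Suc \<eta> by simp
qed simp

lemma gd_iter_dist_le: "norm (gd_iter g \<eta> a m - a) \<le> real m * \<eta> * norm (g a)"
proof (induction m)
  case (Suc m)
  let ?z = "gd_iter g \<eta> a m"
  have "norm (gd_iter g \<eta> a (Suc m) - a) \<le> norm (?z - a) + norm (\<eta> *\<^sub>R g ?z)"
    using norm_triangle_ineq4[of "?z - a" "\<eta> *\<^sub>R g ?z"] by (simp add: algebra_simps)
  also have "\<dots> \<le> real m * \<eta> * norm (g a) + \<eta> * norm (g a)"
    using Suc \<eta> gd_iter_gradient_le[of a m] by (intro add_mono) auto
  finally show ?case by (simp add: algebra_simps)
qed simp

text \<open>Compares \<open>m\<close> small steps with a single step of length
  \<open>m * \<eta>\<close> from \<open>a\<close>. Step \<open>m\<close> adds an error of at most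
  \<open>L * m * \<eta>\<^sup>2 * norm (g a)\<close>, and the numbers below \<open>m\<close> sum to
  at most \<open>m\<^sup>2 / 2\<close>.\<close>

lemma gd_iter_drift_le:
  "norm (a - gd_iter g \<eta> a m - (real m * \<eta>) *\<^sub>R g a) \<le> L * (real m * \<eta>)\<^sup>2 * norm (g a) / 2"
proof (induction m)
  case (Suc m)
  let ?z = "gd_iter g \<eta> a m"
  have "norm (a - gd_iter g \<eta> a (Suc m) - (real (Suc m) * \<eta>) *\<^sub>R g a)
      = norm ((a - ?z - (real m * \<eta>) *\<^sub>R g a) + \<eta> *\<^sub>R (g ?z - g a))"
    by (simp add: algebra_simps)
  also have "\<dots> \<le> norm (a - ?z - (real m * \<eta>) *\<^sub>R g a) + \<eta> * norm (g ?z - g a)"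
    using \<eta> norm_triangle_ineq[of "a - ?z - (real m * \<eta>) *\<^sub>R g a" "\<eta> *\<^sub>R (g ?z - g a)"] by simp
  also have "\<dots> \<le> L * (real m * \<eta>)\<^sup>2 * norm (g a) / 2 + \<eta> * (L * (real m * \<eta> * norm (g a)))"
    using Suc \<eta> L order_trans[OF cocoercive_imp_lipschitz[OF coco L] mult_left_mono[OF gd_iter_dist_le L]]
    by (intro add_mono mult_left_mono) auto
  also have "\<dots> \<le> L * (real (Suc m) * \<eta>)\<^sup>2 * norm (g a) / 2"
  proof -
    have "0 \<le> L * (\<eta> * \<eta> * norm (g a))" using L by simp
    then show ?thesis by (simp add: power2_eq_square algebra_simps)
  qed
  finally show ?case .
qed simp

text \<open>Up to the drift, the round is one gradient step of length \<open>c\<close>. With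
  \<open>s = g a \<bullet> e\<close>, the drift costs \<open>c\<^sup>2 * q * ell * s\<close> and the
  squared displacement \<open>c\<^sup>2 * ell * s\<close>, so the squared distance drops by at least
  \<open>c * s * (2 - c * ell * (1 + q))\<close>; then \<open>qsm\<close> bounds \<open>s\<close>
  from below.\<close>

lemma gd_iter_contraction:
  fixes \<mu> ell q :: real and m :: nat and a xs :: 'a
  defines "c \<equiv> real m * \<eta>"
  assumes qsm: "\<mu> * (norm (a - xs))\<^sup>2 \<le> g a \<bullet> (a - xs)"
    and sco: "1 / ell * (norm (g a))\<^sup>2 \<le> g a \<bullet> (a - xs)"
    and pos: "0 < \<mu>" "0 < ell" and q: "0 \<le> q" "L = q * sqrt (ell * \<mu>)"
    and c: "c * (ell * (1 + 2 * q)) \<le> 1"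
  shows "(norm (gd_iter g \<eta> a m - xs))\<^sup>2
    \<le> (1 - c * \<mu> * (1 + q / (1 + 2 * q))) * (norm (a - xs))\<^sup>2"
proof -
  define e u s where "e = a - xs" and "u = a - gd_iter g \<eta> a m" and "s = g a \<bullet> e"
  have sco': "(norm (g a))\<^sup>2 \<le> ell * s"
    using sco pos by (simp add: s_def e_def pos_divide_le_eq mult.commute)
  have qsm': "\<mu> * (norm e)\<^sup>2 \<le> s" using qsm by (simp add: s_def e_def)
  have c0: "0 \<le> c" using \<eta> by (simp add: c_def)
  have "norm u \<le> c * norm (g a)"
    using gd_iter_dist_le[of a m] by (simp add: u_def c_def norm_minus_commute)
  then have "(norm u)\<^sup>2 \<le> (c * norm (g a))\<^sup>2" by (rule power_mono) simp
  also have "\<dots> = c\<^sup>2 * (norm (g a))\<^sup>2" by (simp add: power_mult_distrib)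
  also have "\<dots> \<le> c\<^sup>2 * (ell * s)"
    by (intro mult_left_mono sco') simp
  finally have u: "(norm u)\<^sup>2 \<le> c\<^sup>2 * ell * s" by (simp add: mult.assoc)
  have s0: "0 \<le> s" using pos by (intro order_trans[OF _ qsm']) auto
  \<comment> \<open>Multiplying \<open>sco'\<close> and \<open>qsm'\<close> bounds the product of
    the two norms by \<open>s\<close>; this is where the ratio
    \<open>q = L / sqrt (ell * \<mu>)\<close> comes from.\<close>
  have "L * (norm (g a) * norm e) \<le> q * ell * s"
  proof -
    have "(sqrt (ell * \<mu>) * (norm (g a) * norm e))\<^sup>2 = (norm (g a))\<^sup>2 * (ell * (\<mu> * (norm e)\<^sup>2))"
      using pos by (simp add: power_mult_distrib)
    also have "\<dots> \<le> (ell * s) * (ell * s)"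
      using pos s0 by (intro mult_mono mult_left_mono sco' qsm') auto
    finally have "sqrt (ell * \<mu>) * (norm (g a) * norm e) \<le> ell * s"
      unfolding power2_eq_square[of "ell * s", symmetric]
      using pos s0 by (rule_tac power2_le_imp_le) auto
    from mult_left_mono[OF this q(1)] show ?thesis by (simp add: q mult.assoc)
  qed
  moreover have "norm ((u - c *\<^sub>R g a)) * norm e \<le> (L * c\<^sup>2 * norm (g a) / 2) * norm e"
    using gd_iter_drift_le[of a m] by (intro mult_right_mono) (simp_all add: u_def c_def)
  moreover have "- ((u - c *\<^sub>R g a) \<bullet> e) \<le> norm (u - c *\<^sub>R g a) * norm e"
    using norm_cauchy_schwarz[of "- (u - c *\<^sub>R g a)" e] by (simp only: inner_minus_left norm_minus_cancel)
  ultimately have "- (u \<bullet> e) + c * s \<le> c\<^sup>2 / 2 * (L * (norm (g a) * norm e))"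
    and "L * (norm (g a) * norm e) \<le> q * ell * s"
    by (simp_all add: inner_diff_left s_def field_simps)
  moreover from this(2) have "c\<^sup>2 / 2 * (L * (norm (g a) * norm e)) \<le> c\<^sup>2 / 2 * (q * ell * s)"
    by (intro mult_left_mono) auto
  ultimately have ue: "- 2 * (u \<bullet> e) \<le> - 2 * c * s + c\<^sup>2 * (q * ell * s)" by simp
  \<comment> \<open>The step size condition has \<open>1 + 2 * q\<close> where \<open>1 + q\<close>
    would already give contraction by \<open>1 - c * \<mu>\<close>; the difference is the surplus
    that later pays for the noise bias.\<close>
  have frac: "c * (ell * (1 + q)) \<le> 1 - q / (1 + 2 * q)"
  proof -
    have "c * (ell * (1 + q)) = c * (ell * (1 + 2 * q)) * ((1 + q) / (1 + 2 * q))"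
      using q by simp
    also have "\<dots> \<le> 1 * ((1 + q) / (1 + 2 * q))"
      using q by (intro mult_right_mono c) auto
    also have "\<dots> = 1 - q / (1 + 2 * q)"
      using q by (simp add: field_simps)
    finally show ?thesis .
  qed
  have "(norm (gd_iter g \<eta> a m - xs))\<^sup>2 = (norm (e - u))\<^sup>2"
    by (simp add: e_def u_def)
  also have "\<dots> = (norm e)\<^sup>2 - 2 * (u \<bullet> e) + (norm u)\<^sup>2"
    by (simp add: power2_norm_eq_inner inner_diff_left inner_diff_right inner_commute)
  also have "\<dots> \<le> (norm e)\<^sup>2 - c * s * (2 - c * (ell * (1 + q)))"
    using ue u by (simp add: algebra_simps power2_eq_square)
  also have "\<dots> \<le> (norm e)\<^sup>2 - c * s * (1 + q / (1 + 2 * q))"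
    using frac c0 s0 by (intro diff_left_mono mult_left_mono) auto
  also have "\<dots> \<le> (norm e)\<^sup>2 - c * (\<mu> * (norm e)\<^sup>2) * (1 + q / (1 + 2 * q))"
    using c0 q by (intro diff_left_mono mult_right_mono mult_left_mono qsm') auto
  finally show ?thesis by (simp add: e_def algebra_simps)
qed

end

subsection \<open>Independent noise\<close>

text \<open>Takes the place of conditioning on the past \<open>X\<close>: independence makes the
  joint law a product, so by Tonelli a bound with \<open>X\<close> frozen at each value
  \<open>x\<close> integrates to a bound in expectation.\<close>

lemma (in prob_space) nn_integral_indep_var_le:
  fixes h :: "_ \<Rightarrow> ennreal"
  assumes ind: "indep_var N1 X N2 Z"
    and h: "h \<in> borel_measurable (N1 \<Otimes>\<^sub>M N2)" and k: "k \<in> borel_measurable N1"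
    and le: "\<And>x. x \<in> space N1 \<Longrightarrow> (\<integral>\<^sup>+ \<omega>. h (x, Z \<omega>) \<partial>M) \<le> k x"
  shows "(\<integral>\<^sup>+ \<omega>. h (X \<omega>, Z \<omega>) \<partial>M) \<le> (\<integral>\<^sup>+ \<omega>. k (X \<omega>) \<partial>M)"
proof -
  from ind have X [measurable]: "X \<in> measurable M N1" and Z [measurable]: "Z \<in> measurable M N2"
    and eq: "distr M N1 X \<Otimes>\<^sub>M distr M N2 Z = distr M (N1 \<Otimes>\<^sub>M N2) (\<lambda>\<omega>. (X \<omega>, Z \<omega>))"
    by (simp_all add: indep_var_distribution_eq)
  interpret Z: prob_space "distr M N2 Z" by (rule prob_space_distr) simp
  have "(\<integral>\<^sup>+ \<omega>. h (X \<omega>, Z \<omega>) \<partial>M) = (\<integral>\<^sup>+ p. h p \<partial>(distr M N1 X \<Otimes>\<^sub>M distr M N2 Z))"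
    using h unfolding eq by (subst nn_integral_distr) auto
  also have "\<dots> = (\<integral>\<^sup>+ x. \<integral>\<^sup>+ z. h (x, z) \<partial>distr M N2 Z \<partial>distr M N1 X)"
    using h by (subst Z.nn_integral_fst[symmetric]) simp_all
  also have "\<dots> = (\<integral>\<^sup>+ x. \<integral>\<^sup>+ \<omega>. h (x, Z \<omega>) \<partial>M \<partial>distr M N1 X)"
    using h by (intro nn_integral_cong) (simp add: nn_integral_distr measurable_Pair2)
  also have "\<dots> \<le> (\<integral>\<^sup>+ x. k x \<partial>distr M N1 X)"
    by (intro nn_integral_mono le) simp
  also have "\<dots> = (\<integral>\<^sup>+ \<omega>. k (X \<omega>) \<partial>M)"
    using k by (intro nn_integral_distr) auto
  finally show ?thesis .
qed

text \<open>Zero mean removes the cross term with \<open>v\<close>, and pointwise orthogonality of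
  the deviations lets their squares add without cross terms between indices.\<close>

lemma (in prob_space) nn_integral_orthogonal_noise_le:
  fixes e :: "'i \<Rightarrow> 'a \<Rightarrow> 'b::euclidean_space" and s :: "'i \<Rightarrow> real"
  assumes int: "\<And>i. i \<in> I \<Longrightarrow> integrable M (e i)"
    and mean: "\<And>i. i \<in> I \<Longrightarrow> (\<integral>\<omega>. e i \<omega> \<partial>M) = h i"
    and orth: "\<And>i j \<omega>. i \<in> I \<Longrightarrow> j \<in> I \<Longrightarrow> i \<noteq> j \<Longrightarrow> \<omega> \<in> space M \<Longrightarrow>
      (e i \<omega> - h i) \<bullet> (e j \<omega> - h j) = 0"
    and var: "\<And>i. i \<in> I \<Longrightarrow> (\<integral>\<^sup>+ \<omega>. ennreal ((norm (e i \<omega> - h i))\<^sup>2) \<partial>M) \<le> ennreal ((s i)\<^sup>2)"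
    and fin: "finite I"
  shows "(\<integral>\<^sup>+ \<omega>. ennreal ((norm (v - \<eta> *\<^sub>R (\<Sum>i\<in>I. e i \<omega>)))\<^sup>2) \<partial>M)
    \<le> ennreal ((norm (v - \<eta> *\<^sub>R (\<Sum>i\<in>I. h i)))\<^sup>2 + \<eta>\<^sup>2 * (\<Sum>i\<in>I. (s i)\<^sup>2))"
proof -
  define u where "u = v - \<eta> *\<^sub>R (\<Sum>i\<in>I. h i)"
  define \<delta> where "\<delta> i \<omega> = e i \<omega> - h i" for i \<omega>
  define \<phi> where "\<phi> \<omega> = (norm u)\<^sup>2 - 2 * \<eta> * (\<Sum>i\<in>I. u \<bullet> \<delta> i \<omega>) + \<eta>\<^sup>2 * (\<Sum>i\<in>I. (norm (\<delta> i \<omega>))\<^sup>2)" for \<omega>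
  have \<delta>_int: "integrable M (\<delta> i)" and \<delta>_mean: "(\<integral>\<omega>. \<delta> i \<omega> \<partial>M) = 0" if "i \<in> I" for i
    using int[OF that] mean[OF that]
    by (simp_all add: \<delta>_def[abs_def] prob_space)
  \<comment> \<open>The expansion \<open>\<phi>\<close> has a signed term, so linearity is used for
    the Bochner integral; the variance bound supplies the integrability.\<close>
  have sq_int: "integrable M (\<lambda>\<omega>. (norm (\<delta> i \<omega>))\<^sup>2)"
    and sq_le: "(\<integral>\<omega>. (norm (\<delta> i \<omega>))\<^sup>2 \<partial>M) \<le> (s i)\<^sup>2" if "i \<in> I" for i
  proof -
    show *: "integrable M (\<lambda>\<omega>. (norm (\<delta> i \<omega>))\<^sup>2)"
      using borel_measurable_integrable[OF \<delta>_int[OF that]] int[OF that] var[OF that]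
      by (intro integrableI_bounded)
        (auto simp: \<delta>_def[abs_def] intro: le_less_trans intro!: borel_measurable_power)
    show "(\<integral>\<omega>. (norm (\<delta> i \<omega>))\<^sup>2 \<partial>M) \<le> (s i)\<^sup>2"
      using var[OF that] nn_integral_eq_integral[OF *] by (simp add: \<delta>_def)
  qed
  have \<phi>: "(norm (v - \<eta> *\<^sub>R (\<Sum>i\<in>I. e i \<omega>)))\<^sup>2 = \<phi> \<omega>" if "\<omega> \<in> space M" for \<omega>
  proof -
    have "v - \<eta> *\<^sub>R (\<Sum>i\<in>I. e i \<omega>) = u - \<eta> *\<^sub>R (\<Sum>i\<in>I. \<delta> i \<omega>)"
      by (simp add: u_def \<delta>_def sum_subtractf algebra_simps)
    moreover have "(norm (\<Sum>i\<in>I. \<delta> i \<omega>))\<^sup>2 = (\<Sum>i\<in>I. (norm (\<delta> i \<omega>))\<^sup>2)"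
      using orth that fin
      by (intro norm_sum_Pythagorean) (auto simp: pairwise_def orthogonal_def \<delta>_def)
    moreover have "(norm (u - \<eta> *\<^sub>R w))\<^sup>2 = (norm u)\<^sup>2 - 2 * \<eta> * (u \<bullet> w) + \<eta>\<^sup>2 * (norm w)\<^sup>2" for w
      by (simp only: power2_norm_eq_inner inner_diff_left inner_diff_right inner_scaleR_left
          inner_scaleR_right) (simp add: inner_commute power2_eq_square algebra_simps)
    ultimately show ?thesis by (simp add: \<phi>_def inner_sum_right)
  qed
  have \<phi>_int: "integrable M \<phi>"
    unfolding \<phi>_def using \<delta>_int sq_int
    by (auto intro!: Bochner_Integration.integrable_add Bochner_Integration.integrable_diff
        integrable_mult_right Bochner_Integration.integrable_sum)
  have "(\<integral>\<omega>. \<phi> \<omega> \<partial>M) = (norm u)\<^sup>2 - 2 * \<eta> * (\<Sum>i\<in>I. \<integral>\<omega>. u \<bullet> \<delta> i \<omega> \<partial>M)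
      + \<eta>\<^sup>2 * (\<Sum>i\<in>I. \<integral>\<omega>. (norm (\<delta> i \<omega>))\<^sup>2 \<partial>M)"
    unfolding \<phi>_def using \<delta>_int sq_int by (simp add: prob_space)
  also have "\<dots> = (norm u)\<^sup>2 + \<eta>\<^sup>2 * (\<Sum>i\<in>I. \<integral>\<omega>. (norm (\<delta> i \<omega>))\<^sup>2 \<partial>M)"
    using \<delta>_int by (simp add: \<delta>_mean)
  also have "\<dots> \<le> (norm u)\<^sup>2 + \<eta>\<^sup>2 * (\<Sum>i\<in>I. (s i)\<^sup>2)"
    using sq_le by (intro add_left_mono mult_left_mono sum_mono) auto
  finally have le: "(\<integral>\<omega>. \<phi> \<omega> \<partial>M) \<le> \<dots>" .
  have "(\<integral>\<^sup>+ \<omega>. ennreal ((norm (v - \<eta> *\<^sub>R (\<Sum>i\<in>I. e i \<omega>)))\<^sup>2) \<partial>M) = (\<integral>\<^sup>+ \<omega>. ennreal (\<phi> \<omega>) \<partial>M)"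
    by (intro nn_integral_cong) (simp add: \<phi>)
  also have "\<dots> = ennreal (\<integral>\<omega>. \<phi> \<omega> \<partial>M)"
    using \<phi>_int by (intro nn_integral_eq_integral AE_I2) (simp_all flip: \<phi>)
  also have "\<dots> \<le> ennreal ((norm u)\<^sup>2 + \<eta>\<^sup>2 * (\<Sum>i\<in>I. (s i)\<^sup>2))"
    by (rule ennreal_leI[OF le])
  finally show ?thesis by (simp add: u_def)
qed

subsection \<open>Block structure\<close>

lemma bounded_linear_blkproj: "bounded_linear (blkproj Bi)"
  unfolding blkproj_def
  by (intro bounded_linear_sum bounded_linear_scaleR_left[THEN bounded_linear_compose] bounded_linear_inner_left)

lemmas linear_blkproj = bounded_linear.linear[OF bounded_linear_blkproj]
lemmas blkproj_simps =
  linear_add[OF linear_blkproj] linear_diff[OF linear_blkproj] linear_scale[OF linear_blkproj]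

lemma blkproj_in_span: "blkproj Bi x \<in> span Bi"
  unfolding blkproj_def by (intro span_sum span_scale span_base)

lemma blkproj_eq_self:
  assumes "Bi \<subseteq> Basis" "y \<in> span Bi"
  shows "blkproj Bi y = y"
proof -
  have fin: "finite Bi" using assms(1) finite_Basis by (rule finite_subset)
  have "subspace {y. blkproj Bi y = y}"
    by (auto simp: subspace_def blkproj_simps linear_0[OF linear_blkproj])
  moreover have "blkproj Bi b = b" if "b \<in> Bi" for b
  proof -
    have "blkproj Bi b = (\<Sum>c\<in>Bi. if c = b then b else 0)"
      unfolding blkproj_def using that assms(1)
      by (intro sum.cong) (auto simp: inner_Basis subset_iff)
    with that fin show ?thesis by simp
  qed
  ultimately have "span Bi \<subseteq> {y. blkproj Bi y = y}" by (intro span_minimal) auto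
  with assms(2) show ?thesis by auto
qed

lemma blkproj_blkproj: "Bi \<subseteq> Basis \<Longrightarrow> blkproj Bi (blkproj Bi y) = blkproj Bi y"
  by (simp add: blkproj_eq_self blkproj_in_span)

text \<open>The projection is self-adjoint and fixes \<open>u\<close>.\<close>

lemma inner_blkproj:
  assumes "Bi \<subseteq> Basis" "u \<in> span Bi"
  shows "u \<bullet> blkproj Bi h = u \<bullet> h"
proof -
  have "u \<bullet> blkproj Bi h = blkproj Bi u \<bullet> h"
    by (simp add: blkproj_def inner_sum_left inner_sum_right inner_commute mult.commute)
  then show ?thesis by (simp add: blkproj_eq_self[OF assms])
qed

lemma with_block_self: "with_block Bi x (blkproj Bi x) = x"
  by (simp add: with_block_def)

lemma
  assumes "Bi \<subseteq> Basis" "y \<in> span Bi"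
  shows blkproj_with_block: "blkproj Bi (with_block Bi a y) = y"
    and with_block_with_block: "with_block Bi (with_block Bi a y) z = with_block Bi a z"
  by (simp_all add: with_block_def blkproj_simps blkproj_blkproj blkproj_eq_self assms)

text \<open>The mean direction of a local step at \<open>y\<close>: player \<open>i\<close> combines
  the own block of \<open>y\<close> with the other blocks of the anchor \<open>a\<close>. For fixed
  \<open>a\<close> each summand depends on one block of \<open>y\<close> only, which makes this a
  gradient field; the joint field of the game need not be one.\<close>

definition local_field ::
    "nat \<Rightarrow> (nat \<Rightarrow> 'a::euclidean_space set) \<Rightarrow> (nat \<Rightarrow> 'a \<Rightarrow> 'a) \<Rightarrow> 'a \<Rightarrow> 'a \<Rightarrow> 'a" where
  "local_field n B G a y = (\<Sum>i<n. G i (with_block (B i) a (blkproj (B i) y)))"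

lemma local_field_self: "local_field n B G a a = (\<Sum>i<n. G i a)"
  by (simp add: local_field_def with_block_self)

locale basis_blocks =
  fixes n :: nat and B :: "nat \<Rightarrow> 'a::euclidean_space set"
  assumes sub: "\<And>i. i < n \<Longrightarrow> B i \<subseteq> Basis"
    and disj: "\<And>i j. i < n \<Longrightarrow> j < n \<Longrightarrow> i \<noteq> j \<Longrightarrow> B i \<inter> B j = {}"
    and cover: "(\<Union>i<n. B i) = Basis"
begin

lemma sum_blkproj: "(\<Sum>i<n. blkproj (B i) x) = x"
proof -
  have "(\<Sum>i<n. blkproj (B i) x) = (\<Sum>b\<in>(\<Union>i<n. B i). (x \<bullet> b) *\<^sub>R b)"
    unfolding blkproj_def using disj
    by (intro sum.UNION_disjoint[symmetric] ballI finite_subset[OF sub finite_Basis]) auto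
  then show ?thesis by (simp add: cover euclidean_representation)
qed

lemma inner_blocks_eq_0:
  assumes "i < n" "j < n" "i \<noteq> j" "u \<in> span (B i)" "v \<in> span (B j)"
  shows "u \<bullet> v = 0"
proof -
  have "b \<bullet> c = 0" if "b \<in> B i" "c \<in> B j" for b c
  proof (rule inner_not_same_Basis)
    show "b \<in> Basis" "c \<in> Basis"
      using that sub[OF assms(1)] sub[OF assms(2)] by blast+
    show "b \<noteq> c" using that disj[OF assms(1,2,3)] by blast
  qed
  then have "orthogonal c b" if "b \<in> B i" "c \<in> B j" for b c
    using that by (simp add: orthogonal_def inner_commute)
  then have "orthogonal u c" if "c \<in> B j" for c
    using that orthogonal_to_span[OF assms(4), of c] by (simp add: orthogonal_commute)
  then have "orthogonal u v"
    using orthogonal_to_span[OF assms(5), of u] by simp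
  then show ?thesis by (simp add: orthogonal_def)
qed

lemma norm_sum_blocks:
  assumes "\<And>i. i < n \<Longrightarrow> v i \<in> span (B i)"
  shows "(norm (\<Sum>i<n. v i))\<^sup>2 = (\<Sum>i<n. (norm (v i))\<^sup>2)"
  using assms inner_blocks_eq_0
  by (intro norm_sum_Pythagorean) (auto simp: pairwise_def orthogonal_def)

text \<open>With \<open>a\<close> frozen the field is the gradient of the separable sum
  \<open>?\<Phi>\<close>, which is convex because each summand is. Orthogonality of the blocks turns
  the blockwise Lipschitz bounds into one with the same constant \<open>L\<close>.\<close>

lemma local_field_cocoercive:
  fixes f :: "nat \<Rightarrow> 'a \<Rightarrow> real"
  assumes G_block: "\<And>i x. i < n \<Longrightarrow> G i x \<in> span (B i)"
    and G_grad: "\<And>i x. i < n \<Longrightarrow>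
       ((\<lambda>y. f i (with_block (B i) x y)) has_derivative (\<lambda>h. G i x \<bullet> h))
         (at (blkproj (B i) x) within span (B i))"
    and CVX: "\<And>i x. i < n \<Longrightarrow> convex_on (span (B i)) (\<lambda>y. f i (with_block (B i) x y))"
    and SM: "\<And>i x y y'. i < n \<Longrightarrow> y \<in> span (B i) \<Longrightarrow> y' \<in> span (B i) \<Longrightarrow>
       norm (G i (with_block (B i) x y) - G i (with_block (B i) x y')) \<le> L * norm (y - y')"
    and L: "0 \<le> L"
  shows "(norm (local_field n B G a x - local_field n B G a y))\<^sup>2
    \<le> L * ((local_field n B G a x - local_field n B G a y) \<bullet> (x - y))"
proof (rule convex_smooth_gradient_cocoercive[OF _ _ _ L])
  let ?\<Phi> = "\<lambda>y. \<Sum>i<n. f i (with_block (B i) a (blkproj (B i) y))"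
  show "convex_on UNIV ?\<Phi>"
  proof (rule convex_onI)
    fix t :: real and x y :: 'a assume t: "0 < t" "t < 1"
    have "f i (with_block (B i) a (blkproj (B i) ((1 - t) *\<^sub>R x + t *\<^sub>R y)))
          \<le> (1 - t) * f i (with_block (B i) a (blkproj (B i) x))
            + t * f i (with_block (B i) a (blkproj (B i) y))" if i: "i < n" for i
      using t convex_onD[OF CVX[OF i, of a], of t "blkproj (B i) x" "blkproj (B i) y"]
      by (simp add: blkproj_simps blkproj_in_span)
    then show "?\<Phi> ((1 - t) *\<^sub>R x + t *\<^sub>R y) \<le> (1 - t) * ?\<Phi> x + t * ?\<Phi> y"
      unfolding sum_distrib_left sum.distrib[symmetric] by (intro sum_mono) simp
  qed simp
  show "(?\<Phi> has_derivative (\<lambda>h. local_field n B G a x \<bullet> h)) (at x)" for x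
  proof -
    have "((\<lambda>y. f i (with_block (B i) a (blkproj (B i) y))) has_derivative
        (\<lambda>h. G i (with_block (B i) a (blkproj (B i) x)) \<bullet> h)) (at x)" if i: "i < n" for i
    proof -
      let ?x = "with_block (B i) a (blkproj (B i) x)"
      have "((\<lambda>y. f i (with_block (B i) a y)) has_derivative (\<lambda>h. G i ?x \<bullet> h))
          (at (blkproj (B i) x) within span (B i))"
        using G_grad[OF i, of ?x] sub[OF i]
        by (simp add: blkproj_with_block with_block_with_block blkproj_in_span)
      then have "((\<lambda>y. f i (with_block (B i) a y)) has_derivative (\<lambda>h. G i ?x \<bullet> h))
          (at (blkproj (B i) x) within range (blkproj (B i)))"
        by (rule has_derivative_subset) (auto simp: blkproj_in_span)
      \<comment> \<open>The chain rule gives the inner product of \<open>G i ?x\<close> with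
        \<open>blkproj (B i) h\<close>; the projection drops out because \<open>G i ?x\<close> lies
        in \<open>span (B i)\<close>.\<close>
      from has_derivative_in_compose[OF bounded_linear.has_derivative[OF bounded_linear_blkproj has_derivative_ident] this]
      show ?thesis
        using inner_blkproj[OF sub[OF i] G_block[OF i]] by simp
    qed
    then have "(?\<Phi> has_derivative (\<lambda>h. \<Sum>i<n. G i (with_block (B i) a (blkproj (B i) x)) \<bullet> h)) (at x)"
      by (intro has_derivative_sum) auto
    then show ?thesis by (simp add: local_field_def inner_sum_left)
  qed
  show "norm (local_field n B G a x - local_field n B G a y) \<le> L * norm (x - y)" for x y
  proof (rule power2_le_imp_le)
    let ?w = "\<lambda>i z. with_block (B i) a (blkproj (B i) z)"
    have "(norm (local_field n B G a x - local_field n B G a y))\<^sup>2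
        = (norm (\<Sum>i<n. G i (?w i x) - G i (?w i y)))\<^sup>2"
      by (simp add: local_field_def sum_subtractf)
    also have "\<dots> = (\<Sum>i<n. (norm (G i (?w i x) - G i (?w i y)))\<^sup>2)"
      by (intro norm_sum_blocks span_diff G_block)
    also have "\<dots> \<le> (\<Sum>i<n. (L * norm (blkproj (B i) (x - y)))\<^sup>2)"
      by (intro sum_mono power_mono) (simp_all add: SM blkproj_in_span blkproj_simps)
    also have "\<dots> = L\<^sup>2 * (norm (\<Sum>i<n. blkproj (B i) (x - y)))\<^sup>2"
      by (simp add: norm_sum_blocks blkproj_in_span power_mult_distrib sum_distrib_left)
    also have "\<dots> = (L * norm (x - y))\<^sup>2"
      by (simp only: sum_blkproj power_mult_distrib)
    finally show "(norm (local_field n B G a x - local_field n B G a y))\<^sup>2 \<le> (L * norm (x - y))\<^sup>2" .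
  qed (use L in simp)
qed

end

subsection \<open>Drift of the local iterates within a round\<close>

text \<open>The weights are chosen so that the expected potential does not increase along the local steps:
each step moves a part \<open>\<eta>\<Lambda>|y - z|^2 + \<eta>\<theta>|w|^2 + N\<close> of it into the main term, where \<open>\<theta>\<Lambda> = L^2\<close> lets
Young's inequality bound the bias \<open>2 L |y - z| |w|\<close>, and \<open>N\<close> pays for the noise.\<close>

definition drift_potential ::
    "('a::real_inner \<Rightarrow> 'a) \<Rightarrow> real \<Rightarrow> real \<Rightarrow> real \<Rightarrow> real \<Rightarrow> nat \<Rightarrow> 'a \<Rightarrow> 'a \<Rightarrow> nat \<Rightarrow> 'a \<Rightarrow> real" where
  "drift_potential g \<eta> \<Lambda> \<theta> N \<tau> xs a m y =
     (let z = gd_iter g \<eta> a m; w = gd_iter g \<eta> a \<tau> - xs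
      in (norm (y - z + w))\<^sup>2 + real (\<tau> - m) * \<eta> * \<Lambda> * (norm (y - z))\<^sup>2
         + real (\<tau> - m) * (\<eta> * \<theta> * (norm w)\<^sup>2 + N))"

lemma drift_potential_start:
  "drift_potential g \<eta> \<Lambda> \<theta> N \<tau> xs a 0 a =
     (1 + real \<tau> * \<eta> * \<theta>) * (norm (gd_iter g \<eta> a \<tau> - xs))\<^sup>2 + real \<tau> * N"
  by (simp add: drift_potential_def algebra_simps)

lemma drift_potential_end: "drift_potential g \<eta> \<Lambda> \<theta> N \<tau> xs a \<tau> y = (norm (y - xs))\<^sup>2"
  by (simp add: drift_potential_def)

text \<open>Nonexpansiveness controls both squares except for the cross term of \<open>D\<close>
  with the fixed vector \<open>w\<close>, which the Lipschitz bound and Young's inequality split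
  into the two extra terms.\<close>

lemma drift_step_le:
  fixes g :: "'a::real_inner \<Rightarrow> 'a"
  assumes coco: "(norm (g y - g z))\<^sup>2 \<le> L * ((g y - g z) \<bullet> (y - z))"
    and L: "0 \<le> L" and \<eta>: "0 \<le> \<eta>" "\<eta> * L \<le> 2"
    and \<theta>: "0 \<le> \<theta>" "0 \<le> \<Lambda>" "\<theta> * \<Lambda> = L\<^sup>2" and b: "0 \<le> b"
  defines "d \<equiv> y - z" and "D \<equiv> g y - g z"
  shows "(norm (d - \<eta> *\<^sub>R D + w))\<^sup>2 + b * (norm (d - \<eta> *\<^sub>R D))\<^sup>2
    \<le> (norm (d + w))\<^sup>2 + (b + \<eta> * \<Lambda>) * (norm d)\<^sup>2 + \<eta> * \<theta> * (norm w)\<^sup>2"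
proof -
  have ne: "(norm (d - \<eta> *\<^sub>R D))\<^sup>2 \<le> (norm d)\<^sup>2"
    using cocoercive_gradient_step_nonexpansive[OF coco \<eta> L] by (intro power_mono) (auto simp: d_def D_def)
  have "- (D \<bullet> w) \<le> norm D * norm w"
    using norm_cauchy_schwarz[of "- D" w] by simp
  also have "\<dots> \<le> (L * norm d) * norm w"
    using cocoercive_imp_lipschitz[OF coco L] by (intro mult_right_mono) (auto simp: d_def D_def)
  finally have Dw: "- 2 * (D \<bullet> w) \<le> 2 * (L * (norm d * norm w))" by simp
  \<comment> \<open>Splitting \<open>L\<close> in this way gives Young's inequality the weights
    \<open>\<theta>\<close> and \<open>\<Lambda>\<close>.\<close>
  have "L = sqrt \<theta> * sqrt \<Lambda>" using L \<theta>(3) by (simp flip: real_sqrt_mult)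
  then have "2 * (L * (norm d * norm w)) = 2 * (sqrt \<theta> * norm w) * (sqrt \<Lambda> * norm d)" by simp
  also have "\<dots> \<le> (sqrt \<theta> * norm w)\<^sup>2 + (sqrt \<Lambda> * norm d)\<^sup>2" by (rule sum_squares_bound)
  also have "\<dots> = \<theta> * (norm w)\<^sup>2 + \<Lambda> * (norm d)\<^sup>2" using \<theta> by (simp add: power_mult_distrib)
  finally have "- 2 * (D \<bullet> w) \<le> \<theta> * (norm w)\<^sup>2 + \<Lambda> * (norm d)\<^sup>2" using Dw by linarith
  then have "\<eta> * (- 2 * (D \<bullet> w)) \<le> \<eta> * (\<theta> * (norm w)\<^sup>2 + \<Lambda> * (norm d)\<^sup>2)"
    using \<eta> by (intro mult_left_mono)
  \<comment> \<open>An exact identity: replacing \<open>d\<close> by its successor changes the inner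
    product with \<open>w\<close> only by \<open>- \<eta> * (D \<bullet> w)\<close>.\<close>
  moreover have "(norm (d - \<eta> *\<^sub>R D + w))\<^sup>2
      = (norm (d - \<eta> *\<^sub>R D))\<^sup>2 + (norm (d + w))\<^sup>2 - (norm d)\<^sup>2 + \<eta> * (- 2 * (D \<bullet> w))"
    by (simp only: power2_norm_eq_inner inner_diff_left inner_diff_right inner_add_left
        inner_add_right inner_scaleR_left inner_scaleR_right)
      (simp add: inner_commute algebra_simps)
  moreover have "b * (norm (d - \<eta> *\<^sub>R D))\<^sup>2 \<le> b * (norm d)\<^sup>2" by (intro mult_left_mono ne b)
  ultimately show ?thesis using ne unfolding distrib_left distrib_right mult.assoc by linarith
qed

text \<open>Here \<open>y\<close> and \<open>a\<close> are frozen and only the new samples are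
  random. The noise enters the two squares with weights 1 and \<open>b\<close>, and
  \<open>drift_step_le\<close> handles what remains. Lowering the number of remaining steps from
  \<open>r + 1\<close> to \<open>r\<close> releases exactly the terms that pay for both.\<close>

lemma (in prob_space) drift_potential_step:
  fixes g :: "'b::euclidean_space \<Rightarrow> 'b" and e :: "'i \<Rightarrow> 'a \<Rightarrow> 'b" and s :: "'i \<Rightarrow> real"
  assumes int: "\<And>i. i \<in> I \<Longrightarrow> integrable M (e i)"
    and mean: "\<And>i. i \<in> I \<Longrightarrow> (\<integral>\<omega>. e i \<omega> \<partial>M) = h i"
    and orth: "\<And>i j \<omega>. i \<in> I \<Longrightarrow> j \<in> I \<Longrightarrow> i \<noteq> j \<Longrightarrow> \<omega> \<in> space M \<Longrightarrow>
      (e i \<omega> - h i) \<bullet> (e j \<omega> - h j) = 0"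
    and var: "\<And>i. i \<in> I \<Longrightarrow> (\<integral>\<^sup>+ \<omega>. ennreal ((norm (e i \<omega> - h i))\<^sup>2) \<partial>M) \<le> ennreal ((s i)\<^sup>2)"
    and fin: "finite I" and gy: "(\<Sum>i\<in>I. h i) = g y"
    and coco: "\<And>x y. (norm (g x - g y))\<^sup>2 \<le> L * ((g x - g y) \<bullet> (x - y))"
    and L: "0 \<le> L" and \<eta>: "0 < \<eta>" "\<eta> * L \<le> 2"
    and \<theta>: "0 \<le> \<theta>" "0 \<le> \<Lambda>" "\<theta> * \<Lambda> = L\<^sup>2"
    and q: "real \<tau> * \<eta> * \<Lambda> \<le> q" and m: "m < \<tau>"
  defines "N \<equiv> (1 + q) * \<eta>\<^sup>2 * (\<Sum>i\<in>I. (s i)\<^sup>2)"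
  shows "(\<integral>\<^sup>+ \<omega>. ennreal (drift_potential g \<eta> \<Lambda> \<theta> N \<tau> xs a (Suc m) (y - \<eta> *\<^sub>R (\<Sum>i\<in>I. e i \<omega>))) \<partial>M)
    \<le> ennreal (drift_potential g \<eta> \<Lambda> \<theta> N \<tau> xs a m y)"
proof -
  define z z' w r b where "z = gd_iter g \<eta> a m" and "z' = gd_iter g \<eta> a (Suc m)"
    and "w = gd_iter g \<eta> a \<tau> - xs" and "r = real (\<tau> - Suc m)" and "b = r * \<eta> * \<Lambda>"
  define K where "K = \<eta> * \<theta> * (norm w)\<^sup>2 + N"
  define \<sigma>2 where "\<sigma>2 = (\<Sum>i\<in>I. (s i)\<^sup>2)"
  have \<sigma>2: "0 \<le> \<sigma>2" by (simp add: \<sigma>2_def sum_nonneg)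
  have q0: "0 \<le> q" using q \<eta> \<theta> by (intro order_trans[OF _ q]) auto
  have N: "N = (1 + q) * \<eta>\<^sup>2 * \<sigma>2" by (simp add: N_def \<sigma>2_def)
  have r0: "0 \<le> r" and b0: "0 \<le> b" and K0: "0 \<le> K"
    using \<eta> \<theta> q0 \<sigma>2 by (simp_all add: r_def b_def K_def N)
  have rm: "real (\<tau> - m) = r + 1" using m by (simp add: r_def of_nat_diff)
  \<comment> \<open>Hence the total noise weight \<open>1 + b\<close> is at most
    \<open>1 + q\<close>, the factor in \<open>N\<close>.\<close>
  have bq: "b \<le> q"
  proof -
    have "b \<le> real \<tau> * \<eta> * \<Lambda>"
      unfolding b_def using \<eta> \<theta> by (intro mult_right_mono) (auto simp: r_def)
    with q show ?thesis by simp
  qed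
  define X where "X \<omega> = \<eta> *\<^sub>R (\<Sum>i\<in>I. e i \<omega>)" for \<omega>
  have X: "X \<in> borel_measurable M"
    unfolding X_def[abs_def] using borel_measurable_integrable[OF int] by measurable
  have noise: "(\<integral>\<^sup>+ \<omega>. ennreal ((norm (v - X \<omega>))\<^sup>2) \<partial>M) \<le> ennreal ((norm (v - \<eta> *\<^sub>R g y))\<^sup>2 + \<eta>\<^sup>2 * \<sigma>2)" for v
    using nn_integral_orthogonal_noise_le[where I = I and e = e and h = h and s = s and v = v and \<eta> = \<eta>,
        OF int mean orth var fin]
    by (simp add: X_def gy \<sigma>2_def)
  have "(\<integral>\<^sup>+ \<omega>. ennreal (drift_potential g \<eta> \<Lambda> \<theta> N \<tau> xs a (Suc m) (y - X \<omega>)) \<partial>M)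
      = (\<integral>\<^sup>+ \<omega>. ennreal ((norm ((y - z' + w) - X \<omega>))\<^sup>2) + ennreal b * ennreal ((norm ((y - z') - X \<omega>))\<^sup>2)
           + ennreal (r * K) \<partial>M)"
  proof (intro nn_integral_cong)
    fix \<omega>
    have eqs: "y - X \<omega> - z' + w = (y - z' + w) - X \<omega>" "y - X \<omega> - z' = (y - z') - X \<omega>" by simp_all
    show "ennreal (drift_potential g \<eta> \<Lambda> \<theta> N \<tau> xs a (Suc m) (y - X \<omega>))
      = ennreal ((norm ((y - z' + w) - X \<omega>))\<^sup>2) + ennreal b * ennreal ((norm ((y - z') - X \<omega>))\<^sup>2)
           + ennreal (r * K)"
      unfolding drift_potential_def Let_def z'_def[symmetric] w_def[symmetric] r_def[symmetric]
        b_def[symmetric] K_def[symmetric] eqs(1) unfolding eqs(2)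
      using b0 r0 K0 by (simp add: ennreal_plus ennreal_mult)
  qed
  also have "\<dots> = (\<integral>\<^sup>+ \<omega>. ennreal ((norm ((y - z' + w) - X \<omega>))\<^sup>2) \<partial>M)
      + ennreal b * (\<integral>\<^sup>+ \<omega>. ennreal ((norm ((y - z') - X \<omega>))\<^sup>2) \<partial>M) + ennreal (r * K)"
    using X by (simp add: nn_integral_add nn_integral_cmult emeasure_space_1)
  also have "\<dots> \<le> ennreal ((norm ((y - z' + w) - \<eta> *\<^sub>R g y))\<^sup>2 + \<eta>\<^sup>2 * \<sigma>2)
      + ennreal b * ennreal ((norm ((y - z') - \<eta> *\<^sub>R g y))\<^sup>2 + \<eta>\<^sup>2 * \<sigma>2) + ennreal (r * K)"
    by (intro add_mono mult_left_mono noise) auto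
  also have "\<dots> = ennreal ((norm ((y - z' + w) - \<eta> *\<^sub>R g y))\<^sup>2 + b * (norm ((y - z') - \<eta> *\<^sub>R g y))\<^sup>2
      + (1 + b) * (\<eta>\<^sup>2 * \<sigma>2) + r * K)"
    using b0 r0 K0 \<sigma>2 by (simp add: algebra_simps flip: ennreal_plus ennreal_mult)
  also have "\<dots> \<le> ennreal (drift_potential g \<eta> \<Lambda> \<theta> N \<tau> xs a m y)"
  proof (rule ennreal_leI)
    have shift: "y - z' + w - \<eta> *\<^sub>R g y = (y - z) - \<eta> *\<^sub>R (g y - g z) + w"
      "y - z' - \<eta> *\<^sub>R g y = (y - z) - \<eta> *\<^sub>R (g y - g z)"
      by (simp_all add: z'_def z_def algebra_simps)
    have "(norm ((y - z' + w) - \<eta> *\<^sub>R g y))\<^sup>2 + b * (norm ((y - z') - \<eta> *\<^sub>R g y))\<^sup>2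
        \<le> (norm (y - z + w))\<^sup>2 + (b + \<eta> * \<Lambda>) * (norm (y - z))\<^sup>2 + \<eta> * \<theta> * (norm w)\<^sup>2"
      unfolding shift using drift_step_le[where g = g and y = y and z = z and w = w,
        OF coco L less_imp_le[OF \<eta>(1)] \<eta>(2) \<theta> b0] by simp
    moreover have "(1 + b) * (\<eta>\<^sup>2 * \<sigma>2) \<le> N"
      unfolding N mult.assoc[of "1 + q"] using bq \<sigma>2 by (intro mult_right_mono) auto
    moreover have "drift_potential g \<eta> \<Lambda> \<theta> N \<tau> xs a m y
        = (norm (y - z + w))\<^sup>2 + (r + 1) * \<eta> * \<Lambda> * (norm (y - z))\<^sup>2 + (r + 1) * K"
      by (simp only: drift_potential_def Let_def z_def w_def K_def rm)
    ultimately show "(norm ((y - z' + w) - \<eta> *\<^sub>R g y))\<^sup>2 + b * (norm ((y - z') - \<eta> *\<^sub>R g y))\<^sup>2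
        + (1 + b) * (\<eta>\<^sup>2 * \<sigma>2) + r * K \<le> drift_potential g \<eta> \<Lambda> \<theta> N \<tau> xs a m y"
      by (simp add: b_def K_def algebra_simps)
  qed
  finally show ?thesis by (simp add: X_def)
qed

subsection \<open>The expected error over a round\<close>

lemma borel_measurable_blkproj [measurable]: "blkproj Bi \<in> borel_measurable borel"
  by (intro borel_measurable_continuous_onI linear_continuous_on bounded_linear_blkproj)

lemma borel_measurable_with_block [measurable (raw)]:
  assumes "u \<in> borel_measurable N" "v \<in> borel_measurable N"
  shows "(\<lambda>\<omega>. with_block Bi (u \<omega>) (v \<omega>)) \<in> borel_measurable N"
  unfolding with_block_def using assms by measurable

text \<open>Together with \<open>pearl_anchor_cong\<close> this expresses that iterates depend only
  on samples drawn strictly earlier, so they factor through the restricted past.\<close>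

lemma pearl_local_cong:
  assumes "\<And>i j. i < n \<Longrightarrow> j < m \<Longrightarrow> xi i (\<tau> * p + j) = xi' i (\<tau> * p + j)"
  shows "pearl_local n B g \<gamma> \<tau> xi a p m = pearl_local n B g \<gamma> \<tau> xi' a p m"
  using assms by (induction m) (simp_all add: Let_def)

lemma pearl_anchor_cong:
  assumes "\<And>i k. i < n \<Longrightarrow> k < \<tau> * p \<Longrightarrow> xi i k = xi' i k"
  shows "pearl_anchor n B g \<gamma> \<tau> xi a p = pearl_anchor n B g \<gamma> \<tau> xi' a p"
  using assms
proof (induction p)
  case (Suc p)
  have "pearl_anchor n B g \<gamma> \<tau> xi a p = pearl_anchor n B g \<gamma> \<tau> xi' a p"
    by (intro Suc.IH Suc.prems) auto
  then show ?case
    using Suc.prems by (auto intro!: pearl_local_cong)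
qed simp

text \<open>Cocoercivity of all local fields stands in for convexity and smoothness.
  \<open>K\<close> is the number of steps for which samples are provided, and \<open>q\<close> is
  tied to \<open>L\<close> as in the step sizes.\<close>

locale pearl_sgd = basis_blocks n B + prob_space M
  for n :: nat and B :: "nat \<Rightarrow> 'a::euclidean_space set" and M :: "'c measure" +
  fixes G :: "nat \<Rightarrow> 'a \<Rightarrow> 'a" and S :: "'b measure" and D :: "nat \<Rightarrow> 'b measure"
    and gs :: "nat \<Rightarrow> 'b \<Rightarrow> 'a \<Rightarrow> 'a" and \<sigma> :: "nat \<Rightarrow> real" and L q \<mu> ell :: real
    and xs x0 :: 'a and \<xi> :: "nat \<Rightarrow> nat \<Rightarrow> 'c \<Rightarrow> 'b" and \<tau> K :: nat and \<gamma> :: "nat \<Rightarrow> real"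
  assumes G_block: "\<And>i x. i < n \<Longrightarrow> G i x \<in> span (B i)"
    and D_prob: "\<And>i. i < n \<Longrightarrow> prob_space (D i)"
    and D_sets: "\<And>i. i < n \<Longrightarrow> sets (D i) = sets S"
    and gs_block: "\<And>i s x. i < n \<Longrightarrow> s \<in> space S \<Longrightarrow> gs i s x \<in> span (B i)"
    and gs_meas: "\<And>i. i < n \<Longrightarrow> (\<lambda>(s, x). gs i s x) \<in> borel_measurable (S \<Otimes>\<^sub>M borel)"
    and gs_int: "\<And>i x. i < n \<Longrightarrow> integrable (D i) (\<lambda>s. gs i s x)"
    and unbiased: "\<And>i x. i < n \<Longrightarrow> (\<integral>s. gs i s x \<partial>D i) = G i x"
    and BV: "\<And>i x. i < n \<Longrightarrow>
       (\<integral>\<^sup>+ s. ennreal ((norm (gs i s x - G i x))\<^sup>2) \<partial>D i) \<le> ennreal ((\<sigma> i)\<^sup>2)"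
    and coco: "\<And>a x y. (norm (local_field n B G a x - local_field n B G a y))\<^sup>2
       \<le> L * ((local_field n B G a x - local_field n B G a y) \<bullet> (x - y))"
    and L: "0 \<le> L" and q: "0 \<le> q" "L = q * sqrt (ell * \<mu>)"
    and mu_pos: "0 < \<mu>" and ell_pos: "0 < ell"
    and QSM: "\<And>x. \<mu> * (norm (x - xs))\<^sup>2 \<le> (\<Sum>i<n. G i x) \<bullet> (x - xs)"
    and SCO: "\<And>x. 1 / ell * (norm (\<Sum>i<n. G i x))\<^sup>2 \<le> (\<Sum>i<n. G i x) \<bullet> (x - xs)"
    and xi_indep: "indep_vars (\<lambda>_. S) (\<lambda>(i, k). \<xi> i k) ({..<n} \<times> {..<K})"
    and xi_distr: "\<And>i k. i < n \<Longrightarrow> k < K \<Longrightarrow> distr M S (\<xi> i k) = D i"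
    and tau: "1 \<le> \<tau>"
begin

text \<open>At distance 1 from \<open>xs\<close>, QSM bounds the norm of the joint field below by
  \<open>\<mu>\<close> and SCO bounds it above by \<open>ell\<close>.\<close>

lemma mu_le_ell: "\<mu> \<le> ell"
proof -
  obtain b :: 'a where b: "b \<in> Basis" using nonempty_Basis by blast
  define F where "F = (\<Sum>i<n. G i (xs + b))"
  have "\<mu> \<le> F \<bullet> b" using QSM[of "xs + b"] b by (simp add: F_def)
  moreover have Fb: "F \<bullet> b \<le> norm F" using norm_cauchy_schwarz[of F b] b by simp
  moreover have "norm F \<le> ell"
  proof (cases "F = 0")
    case False
    have "1 / ell * (norm F)\<^sup>2 \<le> norm F" using SCO[of "xs + b"] Fb by (simp add: F_def)
    then have "norm F * norm F \<le> ell * norm F"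
      using ell_pos by (simp add: pos_divide_le_eq power2_eq_square mult.commute)
    with False show ?thesis by simp
  qed (use ell_pos in simp)
  ultimately show ?thesis by simp
qed

lemma xi_measurable: "i < n \<Longrightarrow> k < K \<Longrightarrow> \<xi> i k \<in> measurable M S"
  using xi_indep unfolding indep_vars_def by auto

lemma gs_measurable:
  assumes "i < n" "X \<in> measurable N S" "u \<in> borel_measurable N"
  shows "(\<lambda>\<omega>. gs i (X \<omega>) (u \<omega>)) \<in> borel_measurable N"
  using measurable_compose[OF measurable_Pair[OF assms(2,3)] gs_meas[OF assms(1)]] by simp

text \<open>By unbiasedness \<open>G i\<close> is a parameter integral of the jointly measurable
  \<open>gs i\<close>.\<close>

lemma G_measurable: "i < n \<Longrightarrow> G i \<in> borel_measurable borel"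
proof -
  assume i: "i < n"
  interpret D: prob_space "D i" by (rule D_prob[OF i])
  have "(\<lambda>(x, s). gs i s x) \<in> borel_measurable (borel \<Otimes>\<^sub>M S)"
    using measurable_pair_swap[OF gs_meas[OF i]] by simp
  then have "(\<lambda>(x, s). gs i s x) \<in> borel_measurable (borel \<Otimes>\<^sub>M D i)"
    using measurable_cong_sets[OF sets_pair_measure_cong[OF refl D_sets[OF i]] refl] by blast
  from D.borel_measurable_lebesgue_integral[OF this] show ?thesis
    by (simp add: unbiased[OF i])
qed

lemma local_field_measurable:
  assumes [measurable]: "u \<in> borel_measurable N" "v \<in> borel_measurable N"
  shows "(\<lambda>\<omega>. local_field n B G (u \<omega>) (v \<omega>)) \<in> borel_measurable N"
  unfolding local_field_def
  by (intro borel_measurable_sum measurable_compose[OF _ G_measurable]) simp_all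

lemma gd_iter_measurable:
  assumes "u \<in> borel_measurable N"
  shows "(\<lambda>\<omega>. gd_iter (local_field n B G (u \<omega>)) \<eta> (u \<omega>) m) \<in> borel_measurable N"
proof (induction m)
  case (Suc m)
  have [measurable]: "(\<lambda>\<omega>. local_field n B G (u \<omega>) (gd_iter (local_field n B G (u \<omega>)) \<eta> (u \<omega>) m)) \<in> borel_measurable N"
    by (rule local_field_measurable[OF assms Suc])
  show ?case using Suc by simp
qed (use assms in simp)

lemma drift_potential_measurable:
  assumes [measurable]: "u \<in> borel_measurable N" "v \<in> borel_measurable N"
  shows "(\<lambda>\<omega>. drift_potential (local_field n B G (u \<omega>)) \<eta> \<Lambda> \<theta> V \<tau> xs (u \<omega>) m (v \<omega>)) \<in> borel_measurable N"
proof -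
  note [measurable] = gd_iter_measurable[OF assms(1)]
  show ?thesis unfolding drift_potential_def Let_def by measurable
qed

lemma pearl_local_measurable:
  assumes "u \<in> borel_measurable N"
    and "\<And>i j. i < n \<Longrightarrow> j < m \<Longrightarrow> (\<lambda>\<omega>. X \<omega> i (\<tau> * p + j)) \<in> measurable N S"
  shows "(\<lambda>\<omega>. pearl_local n B gs \<gamma> \<tau> (X \<omega>) (u \<omega>) p m) \<in> borel_measurable N"
  using assms(2)
proof (induction m)
  case (Suc m)
  note [measurable] = assms(1)
  have [measurable]: "(\<lambda>\<omega>. pearl_local n B gs \<gamma> \<tau> (X \<omega>) (u \<omega>) p m) \<in> borel_measurable N"
    by (intro Suc.IH Suc.prems) simp_all
  have "(\<lambda>\<omega>. \<Sum>i<n. gs i (X \<omega> i (\<tau> * p + m)) (with_block (B i) (u \<omega>)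
      (blkproj (B i) (pearl_local n B gs \<gamma> \<tau> (X \<omega>) (u \<omega>) p m)))) \<in> borel_measurable N"
    by (intro borel_measurable_sum gs_measurable Suc.prems) simp_all
  then show ?case by (simp add: Let_def)
qed (use assms in simp)

lemma pearl_anchor_measurable:
  assumes "\<And>i k. i < n \<Longrightarrow> k < \<tau> * p \<Longrightarrow> (\<lambda>\<omega>. X \<omega> i k) \<in> measurable N S"
  shows "(\<lambda>\<omega>. pearl_anchor n B gs \<gamma> \<tau> (X \<omega>) x0 p) \<in> borel_measurable N"
  using assms
proof (induction p)
  case (Suc p)
  have "(\<lambda>\<omega>. pearl_anchor n B gs \<gamma> \<tau> (X \<omega>) x0 p) \<in> borel_measurable N"
    by (intro Suc.IH Suc.prems) simp_all
  then show ?case using Suc.prems by (simp add: pearl_local_measurable)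
qed simp

abbreviation anchor :: "nat \<Rightarrow> 'c \<Rightarrow> 'a" where
  "anchor p \<omega> \<equiv> pearl_anchor n B gs \<gamma> \<tau> (\<lambda>i k. \<xi> i k \<omega>) x0 p"

abbreviation iterate :: "nat \<Rightarrow> nat \<Rightarrow> 'c \<Rightarrow> 'a" where
  "iterate p m \<omega> \<equiv> pearl_local n B gs \<gamma> \<tau> (\<lambda>i k. \<xi> i k \<omega>) (anchor p \<omega>) p m"

text \<open>One round with constant step \<open>\<eta>\<close>. \<open>\<theta>\<close> is
  \<open>\<mu>\<close> times the contraction surplus \<open>q / (1 + 2 * q)\<close>;
  \<open>\<Lambda>\<close> is then determined, for \<open>q > 0\<close>, by
  \<open>\<theta> * \<Lambda> = L\<^sup>2 = q\<^sup>2 * ell * \<mu>\<close>, and \<open>c\<close>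
  gives \<open>\<tau> * \<eta> * \<Lambda> \<le> q\<close>.\<close>

context
  fixes \<eta> \<theta> \<Lambda> V :: real and p :: nat
  assumes \<eta>: "0 < \<eta>" and c: "real \<tau> * \<eta> * (ell * (1 + 2 * q)) \<le> 1"
    and p: "\<tau> * Suc p \<le> K" and \<gamma>: "\<And>m. m < \<tau> \<Longrightarrow> \<gamma> (\<tau> * p + m) = \<eta>"
  defines "\<theta> \<equiv> \<mu> * (q / (1 + 2 * q))" and "\<Lambda> \<equiv> q * ell * (1 + 2 * q)"
    and "V \<equiv> (1 + q) * \<eta>\<^sup>2 * (\<Sum>i<n. (\<sigma> i)\<^sup>2)"
begin

lemma stepsize_L: "\<eta> * L \<le> 2"
proof -
  have "sqrt (ell * \<mu>) \<le> ell"
    using mu_le_ell mu_pos ell_pos by (intro real_le_lsqrt) (auto simp: power2_eq_square)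
  then have "L \<le> q * ell" unfolding q(2) by (intro mult_left_mono q(1))
  also have "\<dots> \<le> (1 + 2 * q) * ell" using q(1) ell_pos by (intro mult_right_mono) auto
  finally have "L \<le> ell * (1 + 2 * q)" by (simp only: mult.commute)
  then have "\<eta> * L \<le> real \<tau> * \<eta> * (ell * (1 + 2 * q))"
    using \<eta> tau L by (intro mult_mono) auto
  with c show ?thesis by simp
qed

lemma coeffs: "0 \<le> \<theta>" "0 \<le> \<Lambda>" "\<theta> * \<Lambda> = L\<^sup>2" "real \<tau> * \<eta> * \<Lambda> \<le> q" "0 \<le> V"
proof -
  show "real \<tau> * \<eta> * \<Lambda> \<le> q"
    using mult_left_mono[OF c q(1)] by (simp add: \<Lambda>_def mult_ac)
  show "\<theta> * \<Lambda> = L\<^sup>2"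
    using q mu_pos ell_pos by (simp add: \<theta>_def \<Lambda>_def power_mult_distrib power2_eq_square)
qed (use q mu_pos ell_pos in \<open>simp_all add: \<theta>_def \<Lambda>_def V_def sum_nonneg\<close>)

text \<open>All samples before step \<open>k\<close> are independent of those at step
  \<open>k\<close>. Anchor and iterate are functions \<open>U\<close> and \<open>Y\<close> of the
  former, so the past is frozen and \<open>drift_potential_step\<close> applied with the players as
  index set.\<close>

lemma expected_potential_step:
  assumes m: "m < \<tau>"
  shows "(\<integral>\<^sup>+ \<omega>. ennreal (drift_potential (local_field n B G (anchor p \<omega>)) \<eta> \<Lambda> \<theta> V \<tau> xs
            (anchor p \<omega>) (Suc m) (iterate p (Suc m) \<omega>)) \<partial>M)
    \<le> (\<integral>\<^sup>+ \<omega>. ennreal (drift_potential (local_field n B G (anchor p \<omega>)) \<eta> \<Lambda> \<theta> V \<tau> xs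
            (anchor p \<omega>) m (iterate p m \<omega>)) \<partial>M)"
proof -
  define k past new where "k = \<tau> * p + m" and "past = {..<n} \<times> {..<k}" and "new = {..<n} \<times> {k}"
  have k: "k < K" using p m by (simp add: k_def)
  define X where "X \<omega> = restrict (\<lambda>j. (case j of (i, k) \<Rightarrow> \<xi> i k) \<omega>) past" for \<omega>
  define Z where "Z \<omega> = restrict (\<lambda>j. (case j of (i, k) \<Rightarrow> \<xi> i k) \<omega>) new" for \<omega>
  have ind: "indep_var (PiM past (\<lambda>_. S)) X (PiM new (\<lambda>_. S)) Z"
    unfolding X_def[abs_def] Z_def[abs_def] using k
    by (intro indep_var_restrict[OF xi_indep]) (auto simp: past_def new_def)
  define U where "U u = pearl_anchor n B gs \<gamma> \<tau> (\<lambda>i k. u (i, k)) x0 p" for u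
  define Y where "Y u = pearl_local n B gs \<gamma> \<tau> (\<lambda>i k. u (i, k)) (U u) p m" for u
  define W where "W i u = with_block (B i) (U u) (blkproj (B i) (Y u))" for i u
  define H where "H u = drift_potential (local_field n B G (U u)) \<eta> \<Lambda> \<theta> V \<tau> xs (U u)" for u
  define h where "h = (\<lambda>(u, v). ennreal (H u (Suc m) (Y u - \<eta> *\<^sub>R (\<Sum>i<n. gs i (v (i, k)) (W i u)))))"
  have comp: "(\<lambda>u. u (i, j)) \<in> measurable (PiM past (\<lambda>_. S)) S" if "i < n" "j < k" for i j
    using that by (intro measurable_component_singleton) (auto simp: past_def)
  have comp': "(\<lambda>v. v (i, k)) \<in> measurable (PiM new (\<lambda>_. S)) S" if "i < n" for i
    using that by (intro measurable_component_singleton) (auto simp: new_def)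
  have U: "U \<in> borel_measurable (PiM past (\<lambda>_. S))"
    unfolding U_def[abs_def] by (intro pearl_anchor_measurable comp) (auto simp: k_def)
  have Y: "Y \<in> borel_measurable (PiM past (\<lambda>_. S))"
    unfolding Y_def[abs_def] by (intro pearl_local_measurable U comp) (auto simp: k_def)
  have UX: "U (X \<omega>) = anchor p \<omega>" and YX: "Y (X \<omega>) = iterate p m \<omega>" for \<omega>
  proof -
    show *: "U (X \<omega>) = anchor p \<omega>"
      unfolding U_def by (intro pearl_anchor_cong) (auto simp: X_def past_def k_def)
    show "Y (X \<omega>) = iterate p m \<omega>"
      unfolding Y_def * by (intro pearl_local_cong) (auto simp: X_def past_def k_def)
  qed
  have "(\<integral>\<^sup>+ \<omega>. h (X \<omega>, Z \<omega>) \<partial>M) \<le> (\<integral>\<^sup>+ \<omega>. ennreal (H (X \<omega>) m (Y (X \<omega>))) \<partial>M)"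
  proof (rule nn_integral_indep_var_le[OF ind])
    show "(\<lambda>u. ennreal (H u m (Y u))) \<in> borel_measurable (PiM past (\<lambda>_. S))"
      unfolding H_def
      by (intro measurable_compose[OF _ measurable_ennreal] drift_potential_measurable U Y)
    have [measurable]: "(\<lambda>w. U (fst w)) \<in> borel_measurable (PiM past (\<lambda>_. S) \<Otimes>\<^sub>M PiM new (\<lambda>_. S))"
      "(\<lambda>w. Y (fst w)) \<in> borel_measurable (PiM past (\<lambda>_. S) \<Otimes>\<^sub>M PiM new (\<lambda>_. S))"
      using measurable_compose[OF measurable_fst U] measurable_compose[OF measurable_fst Y] by blast+
    have "(\<lambda>w. \<Sum>i<n. gs i (snd w (i, k)) (W i (fst w)))
        \<in> borel_measurable (PiM past (\<lambda>_. S) \<Otimes>\<^sub>M PiM new (\<lambda>_. S))"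
      unfolding W_def
      by (intro borel_measurable_sum gs_measurable measurable_compose[OF measurable_snd comp']) simp_all
    then have [measurable]: "(\<lambda>w. Y (fst w) - \<eta> *\<^sub>R (\<Sum>i<n. gs i (snd w (i, k)) (W i (fst w))))
        \<in> borel_measurable (PiM past (\<lambda>_. S) \<Otimes>\<^sub>M PiM new (\<lambda>_. S))"
      by simp
    show "h \<in> borel_measurable (PiM past (\<lambda>_. S) \<Otimes>\<^sub>M PiM new (\<lambda>_. S))"
      unfolding h_def H_def case_prod_beta
      by (intro measurable_compose[OF _ measurable_ennreal] drift_potential_measurable) simp_all
    fix u
    define e where "e i \<omega> = gs i (\<xi> i k \<omega>) (W i u)" for i \<omega>
    have gsW: "(\<lambda>s. gs i s (W i u)) \<in> borel_measurable S" if "i < n" for i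
      using that by (intro gs_measurable) simp_all
    have "h (u, Z \<omega>) = ennreal (H u (Suc m) (Y u - \<eta> *\<^sub>R (\<Sum>i<n. e i \<omega>)))" for \<omega>
      by (simp add: h_def e_def Z_def new_def)
    then have "(\<integral>\<^sup>+ \<omega>. h (u, Z \<omega>) \<partial>M)
        = (\<integral>\<^sup>+ \<omega>. ennreal (H u (Suc m) (Y u - \<eta> *\<^sub>R (\<Sum>i<n. e i \<omega>))) \<partial>M)" by simp
    also have "\<dots> \<le> ennreal (H u m (Y u))"
      unfolding H_def V_def
    proof (rule drift_potential_step[where h = "\<lambda>i. G i (W i u)"])
      fix i assume "i \<in> {..<n}"
      then have i: "i < n" by simp
      note xi = xi_measurable[OF i k] and distr = xi_distr[OF i k, symmetric]
      show "integrable M (e i)"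
        using gs_int[OF i] integrable_distr_eq[OF xi gsW[OF i]]
        by (simp add: e_def[abs_def] distr)
      show "(\<integral>\<omega>. e i \<omega> \<partial>M) = G i (W i u)"
        using unbiased[OF i] integral_distr[OF xi gsW[OF i]] by (simp add: e_def distr)
      show "(\<integral>\<^sup>+ \<omega>. ennreal ((norm (e i \<omega> - G i (W i u)))\<^sup>2) \<partial>M) \<le> ennreal ((\<sigma> i)\<^sup>2)"
      proof -
        have "(\<lambda>s. ennreal ((norm (gs i s (W i u) - G i (W i u)))\<^sup>2)) \<in> borel_measurable S"
          using gsW[OF i] by measurable
        from nn_integral_distr[OF xi, of "\<lambda>s. ennreal ((norm (gs i s (W i u) - G i (W i u)))\<^sup>2)"] this
        show ?thesis using BV[OF i, of "W i u"] by (simp add: e_def distr)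
      qed
      fix j \<omega> assume j: "j \<in> {..<n}" and ij: "i \<noteq> j" and \<omega>: "\<omega> \<in> space M"
      show "(e i \<omega> - G i (W i u)) \<bullet> (e j \<omega> - G j (W j u)) = 0"
      proof (rule inner_blocks_eq_0[OF i _ ij])
        show "j < n" using j by simp
        \<comment> \<open>\<open>gs_block\<close> concerns samples in \<open>space S\<close>;
          membership comes from measurability of the draws.\<close>
        have "\<xi> i k \<omega> \<in> space S" "\<xi> j k \<omega> \<in> space S"
          using measurable_space[OF xi \<omega>] measurable_space[OF xi_measurable[OF _ k] \<omega>] j by simp_all
        then show "e i \<omega> - G i (W i u) \<in> span (B i)" "e j \<omega> - G j (W j u) \<in> span (B j)"
          using i j by (auto intro!: span_diff gs_block G_block simp: e_def)
      qed
    next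
      show "(\<Sum>i<n. G i (W i u)) = local_field n B G (U u) (Y u)"
        by (simp add: local_field_def W_def)
    qed (use coco L \<eta> stepsize_L coeffs m in simp_all)
    finally show "(\<integral>\<^sup>+ \<omega>. h (u, Z \<omega>) \<partial>M) \<le> ennreal (H u m (Y u))" .
  qed
  moreover have "h (X \<omega>, Z \<omega>) = ennreal (drift_potential (local_field n B G (anchor p \<omega>)) \<eta> \<Lambda> \<theta> V \<tau> xs
            (anchor p \<omega>) (Suc m) (iterate p (Suc m) \<omega>))" for \<omega>
    using \<gamma>[OF m] by (simp add: h_def H_def W_def UX YX Z_def new_def k_def Let_def)
  ultimately show ?thesis by (simp add: H_def UX YX)
qed

text \<open>The expected potential is followed from \<open>m = 0\<close>, where
  \<open>gd_iter_contraction\<close> bounds it, to \<open>m = \<tau>\<close>, where it is the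
  squared error of the next anchor.\<close>

lemma expected_round_le:
  "(\<integral>\<^sup>+ \<omega>. ennreal ((norm (anchor (Suc p) \<omega> - xs))\<^sup>2) \<partial>M)
    \<le> ennreal (1 - real \<tau> * \<eta> * \<mu>) * (\<integral>\<^sup>+ \<omega>. ennreal ((norm (anchor p \<omega> - xs))\<^sup>2) \<partial>M)
      + ennreal (real \<tau> * V)"
proof -
  let ?H = "\<lambda>\<omega>. drift_potential (local_field n B G (anchor p \<omega>)) \<eta> \<Lambda> \<theta> V \<tau> xs (anchor p \<omega>)"
  let ?c = "real \<tau> * \<eta>"
  define \<beta> where "\<beta> = q / (1 + 2 * q)"
  have \<beta>: "0 \<le> \<beta>" "\<theta> = \<mu> * \<beta>" using q by (simp_all add: \<beta>_def \<theta>_def)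
  \<comment> \<open>The upper bound 1 keeps \<open>1 - ?c * \<mu>\<close> nonnegative, so that
    \<open>ennreal\<close> does not truncate it.\<close>
  have c\<mu>: "0 \<le> ?c * \<mu>" "?c * \<mu> \<le> 1"
  proof -
    show "0 \<le> ?c * \<mu>" using \<eta> mu_pos by simp
    have "\<mu> \<le> ell * (1 + 2 * q)"
      using mu_le_ell ell_pos q(1) by (intro order_trans[OF mu_le_ell]) simp
    then have "?c * \<mu> \<le> ?c * (ell * (1 + 2 * q))"
      using \<eta> by (intro mult_left_mono) auto
    with c show "?c * \<mu> \<le> 1" by simp
  qed
  have "(\<integral>\<^sup>+ \<omega>. ennreal (?H \<omega> m (iterate p m \<omega>)) \<partial>M) \<le> (\<integral>\<^sup>+ \<omega>. ennreal (?H \<omega> 0 (anchor p \<omega>)) \<partial>M)"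
    if "m \<le> \<tau>" for m
    using that
  proof (induction m)
    case (Suc m)
    then show ?case by (intro order_trans[OF expected_potential_step Suc.IH]) auto
  qed simp
  from this[of \<tau>]
  have "(\<integral>\<^sup>+ \<omega>. ennreal ((norm (anchor (Suc p) \<omega> - xs))\<^sup>2) \<partial>M) \<le> (\<integral>\<^sup>+ \<omega>. ennreal (?H \<omega> 0 (anchor p \<omega>)) \<partial>M)"
    by (simp add: drift_potential_end)
  also have "\<dots> \<le> (\<integral>\<^sup>+ \<omega>. ennreal (1 - ?c * \<mu>) * ennreal ((norm (anchor p \<omega> - xs))\<^sup>2) + ennreal (real \<tau> * V) \<partial>M)"
  proof (rule nn_integral_mono)
    fix \<omega>
    let ?a = "anchor p \<omega>" let ?g = "local_field n B G (anchor p \<omega>)"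
    have "(norm (gd_iter ?g \<eta> ?a \<tau> - xs))\<^sup>2 \<le> (1 - ?c * \<mu> * (1 + \<beta>)) * (norm (?a - xs))\<^sup>2"
      unfolding \<beta>_def using QSM SCO q mu_pos ell_pos c coco L \<eta> stepsize_L
      by (intro gd_iter_contraction[where L = L and ell = ell]) (simp_all add: local_field_self)
    then have "(1 + ?c * \<theta>) * (norm (gd_iter ?g \<eta> ?a \<tau> - xs))\<^sup>2
        \<le> (1 + ?c * \<theta>) * ((1 - ?c * \<mu> * (1 + \<beta>)) * (norm (?a - xs))\<^sup>2)"
      using \<eta> coeffs by (intro mult_left_mono) auto
    \<comment> \<open>As \<open>\<theta> = \<mu> * \<beta>\<close>, the bias factor cancels the
      surplus to first order and leaves a nonpositive second-order term.\<close>
    also have "\<dots> = (1 - ?c * \<mu> - ?c * \<mu> * (?c * \<mu>) * \<beta> * (1 + \<beta>)) * (norm (?a - xs))\<^sup>2"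
      by (simp add: \<beta>(2) algebra_simps)
    also have "\<dots> \<le> (1 - ?c * \<mu>) * (norm (?a - xs))\<^sup>2"
      using c\<mu> \<beta> by (intro mult_right_mono) auto
    finally have "?H \<omega> 0 ?a \<le> (1 - ?c * \<mu>) * (norm (?a - xs))\<^sup>2 + real \<tau> * V"
      by (simp add: drift_potential_start)
    then show "ennreal (?H \<omega> 0 ?a) \<le> ennreal (1 - ?c * \<mu>) * ennreal ((norm (?a - xs))\<^sup>2) + ennreal (real \<tau> * V)"
      using c\<mu> coeffs by (simp add: ennreal_leI flip: ennreal_plus ennreal_mult)
  qed
  also have "\<dots> = ennreal (1 - ?c * \<mu>) * (\<integral>\<^sup>+ \<omega>. ennreal ((norm (anchor p \<omega> - xs))\<^sup>2) \<partial>M) + ennreal (real \<tau> * V)"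
  proof -
    have [measurable]: "anchor p \<in> borel_measurable M"
      using p by (intro pearl_anchor_measurable xi_measurable) auto
    show ?thesis by (simp add: nn_integral_add nn_integral_cmult emeasure_space_1)
  qed
  finally show ?thesis .
qed

end

end

subsection \<open>The two-phase step sizes\<close>

text \<open>The bound \<open>1 + x \<le> exp x\<close> at \<open>x = z / 2 - 1\<close> gives the
  maximum \<open>4 * exp (- 2)\<close>, relaxed to the constant of the theorem.\<close>

lemma square_mult_exp_minus_le:
  fixes z :: real
  assumes "0 \<le> z"
  shows "z\<^sup>2 * exp (- z) \<le> 4 / exp 1"
proof -
  have "z / 2 \<le> exp (z / 2 - 1)" using exp_ge_add_one_self[of "z / 2 - 1"] by simp
  then have "(z / 2)\<^sup>2 \<le> (exp (z / 2 - 1))\<^sup>2" using assms by (intro power_mono) auto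
  also have "\<dots> = exp (z - 2)" by (simp flip: exp_double add: algebra_simps)
  finally have "z\<^sup>2 * exp (- z) \<le> (4 * exp (z - 2)) * exp (- z)"
    by (intro mult_right_mono) (auto simp: power_divide)
  also have "\<dots> = 4 * exp (- 2)" by (simp flip: exp_add)
  also have "\<dots> \<le> 4 * exp (- 1 :: real)" by simp
  finally show ?thesis by (simp add: exp_minus field_simps)
qed

text \<open>\<open>\<beta> p\<close> plays the role of \<open>\<tau> * \<gamma> * \<mu>\<close> in
  round \<open>p\<close>. The constant phase gives geometric decay above a noise floor
  \<open>V * \<alpha>\<close>; in the decreasing phase \<open>p\<^sup>2 * E p\<close> grows by at
  most \<open>4 * V\<close> per round.\<close>

lemma two_phase_recursion_le:
  fixes E :: "nat \<Rightarrow> real" and \<alpha> V :: real and R :: nat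
  defines "\<beta> \<equiv> \<lambda>p. if real p < 2 / \<alpha> then \<alpha> else (2 * real p + 1) / (real p + 1)\<^sup>2"
  assumes \<alpha>: "0 < \<alpha>" "\<alpha> \<le> 1" and V: "0 \<le> V" and E0: "0 \<le> E 0"
    and rec: "\<And>p. E (Suc p) = (1 - \<beta> p) * E p + V * (\<beta> p)\<^sup>2"
  shows "(real r)\<^sup>2 * E r \<le> 4 / (exp 1 * \<alpha>\<^sup>2) * E 0 + V * (2 + \<alpha>)\<^sup>2 / \<alpha> + 4 * real r * V"
proof (induction r)
  case 0
  then show ?case using \<alpha> V E0 by simp
next
  case (Suc r)
  show ?case
  proof (cases "real r < 2 / \<alpha>")
    case True
    \<comment> \<open>The threshold test holds for \<open>r\<close>, so every round up to
      \<open>r\<close> uses \<open>\<alpha>\<close>. The floor \<open>V * \<alpha>\<close> is the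
      fixed point of the recursion.\<close>
    have closed: "E k \<le> (1 - \<alpha>) ^ k * E 0 + V * \<alpha>" if "k \<le> Suc r" for k
      using that
    proof (induction k)
      case 0
      then show ?case using \<alpha> V by simp
    next
      case (Suc k)
      then have "E (Suc k) = (1 - \<alpha>) * E k + V * \<alpha>\<^sup>2"
        using True by (simp add: rec \<beta>_def)
      also have "\<dots> \<le> (1 - \<alpha>) * ((1 - \<alpha>) ^ k * E 0 + V * \<alpha>) + V * \<alpha>\<^sup>2"
        using Suc \<alpha> by (intro add_right_mono mult_left_mono) auto
      finally show ?case by (simp add: algebra_simps power2_eq_square)
    qed
    let ?k = "real (Suc r)"
    have "(1 - \<alpha>) ^ Suc r \<le> exp (- \<alpha>) ^ Suc r"
      using \<alpha> exp_ge_add_one_self[of "- \<alpha>"] by (intro power_mono) auto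
    also have "\<dots> = exp (- (?k * \<alpha>))" by (simp only: exp_of_nat_mult[symmetric] mult_minus_right)
    finally have "(?k * \<alpha>)\<^sup>2 * (1 - \<alpha>) ^ Suc r \<le> (?k * \<alpha>)\<^sup>2 * exp (- (?k * \<alpha>))"
      by (intro mult_left_mono) auto
    also have "\<dots> \<le> 4 / exp 1" using \<alpha> by (intro square_mult_exp_minus_le) simp
    finally have "?k\<^sup>2 * (1 - \<alpha>) ^ Suc r \<le> 4 / exp 1 / \<alpha>\<^sup>2"
      using \<alpha> by (simp add: pos_le_divide_eq power_mult_distrib mult_ac del: power_Suc)
    then have "?k\<^sup>2 * (1 - \<alpha>) ^ Suc r * E 0 \<le> 4 / exp 1 / \<alpha>\<^sup>2 * E 0"
      by (intro mult_right_mono E0)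
    moreover have "?k\<^sup>2 * (V * \<alpha>) \<le> V * (2 + \<alpha>)\<^sup>2 / \<alpha>"
    proof -
      \<comment> \<open>The last constant round satisfies \<open>r < 2 / \<alpha>\<close>, but the
        iterate it produces has index \<open>r + 1\<close>; hence the extra
        \<open>\<alpha>\<close>.\<close>
      have "?k * \<alpha> \<le> 2 + \<alpha>" using True \<alpha> by (simp add: pos_less_divide_eq algebra_simps)
      then have "V * (?k * \<alpha>)\<^sup>2 \<le> V * (2 + \<alpha>)\<^sup>2"
        using V \<alpha> by (intro mult_left_mono power_mono) auto
      then show ?thesis
        using \<alpha> by (simp add: pos_le_divide_eq power_mult_distrib power2_eq_square mult_ac)
    qed
    ultimately have bounds: "?k\<^sup>2 * (1 - \<alpha>) ^ Suc r * E 0 + ?k\<^sup>2 * (V * \<alpha>)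
        \<le> 4 / (exp 1 * \<alpha>\<^sup>2) * E 0 + V * (2 + \<alpha>)\<^sup>2 / \<alpha>"
      unfolding divide_divide_eq_left by (rule add_mono)
    have "?k\<^sup>2 * E (Suc r) \<le> ?k\<^sup>2 * ((1 - \<alpha>) ^ Suc r * E 0 + V * \<alpha>)"
      by (intro mult_left_mono closed) auto
    also have "\<dots> = ?k\<^sup>2 * (1 - \<alpha>) ^ Suc r * E 0 + ?k\<^sup>2 * (V * \<alpha>)"
      by (simp only: distrib_left mult.assoc)
    also note bounds
    also have "4 / (exp 1 * \<alpha>\<^sup>2) * E 0 + V * (2 + \<alpha>)\<^sup>2 / \<alpha>
        \<le> 4 / (exp 1 * \<alpha>\<^sup>2) * E 0 + V * (2 + \<alpha>)\<^sup>2 / \<alpha> + 4 * ?k * V"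
      using V by simp
    finally show ?thesis .
  next
    case False
    let ?s = "real r + 1"
    \<comment> \<open>Multiplying by \<open>(r + 1)\<^sup>2\<close> turns the coefficient of
      \<open>E r\<close> into \<open>(r + 1)\<^sup>2 - (2 * r + 1) = r\<^sup>2\<close>, so the
      recursion telescopes.\<close>
    have split: "s\<^sup>2 * ((1 - c / s\<^sup>2) * x + V * (c / s\<^sup>2)\<^sup>2) = (s\<^sup>2 - c) * x + V * (c / s)\<^sup>2"
      if "s \<noteq> 0" for s c x :: real
      using that by (simp add: field_simps power2_eq_square)
    have "?s\<^sup>2 * E (Suc r) = (?s\<^sup>2 - (2 * real r + 1)) * E r + V * ((2 * real r + 1) / ?s)\<^sup>2"
      using False split[of ?s] by (simp add: rec \<beta>_def)
    also have "?s\<^sup>2 - (2 * real r + 1) = (real r)\<^sup>2" by (simp add: power2_eq_square algebra_simps)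
    also have "V * ((2 * real r + 1) / ?s)\<^sup>2 \<le> V * 2\<^sup>2"
      using V by (intro mult_left_mono power_mono) (auto simp: pos_divide_le_eq)
    finally show ?thesis using Suc.IH by (simp add: algebra_simps)
  qed
qed

theorem theorem3:
  fixes n :: nat and B :: "nat \<Rightarrow> 'a::euclidean_space set"
    and f :: "nat \<Rightarrow> 'a \<Rightarrow> real" and G :: "nat \<Rightarrow> 'a \<Rightarrow> 'a"
    and S :: "'b measure" and D :: "nat \<Rightarrow> 'b measure"
    and fs :: "nat \<Rightarrow> 'b \<Rightarrow> 'a \<Rightarrow> real" and gs :: "nat \<Rightarrow> 'b \<Rightarrow> 'a \<Rightarrow> 'a"
    and L \<sigma> :: "nat \<Rightarrow> real" and \<mu> ell :: real and xs x0 :: 'a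
    and M :: "'c measure" and \<xi> :: "nat \<Rightarrow> nat \<Rightarrow> 'c \<Rightarrow> 'b"
    and \<tau> R :: nat and \<gamma> :: "nat \<Rightarrow> real"
  assumes n: "n \<ge> 1"
    \<comment> \<open>block structure: the basis of R^D is partitioned into the n blocks\<close>
    and blocks_sub: "\<And>i. i < n \<Longrightarrow> B i \<subseteq> Basis"
    and blocks_disj: "\<And>i j. i < n \<Longrightarrow> j < n \<Longrightarrow> i \<noteq> j \<Longrightarrow> B i \<inter> B j = {}"
    and blocks_cover: "(\<Union>i<n. B i) = Basis"
    \<comment> \<open>G i x is the gradient of f_i(.;x^{-i}) in x^i\<close>
    and G_block: "\<And>i x. i < n \<Longrightarrow> G i x \<in> span (B i)"
    and G_grad: "\<And>i x. i < n \<Longrightarrow>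
       ((\<lambda>y. f i (with_block (B i) x y)) has_derivative (\<lambda>h. G i x \<bullet> h))
         (at (blkproj (B i) x) within span (B i))"
    \<comment> \<open>stochastic oracles: f_i = E f_{i,xi}, gs i s x is the gradient of f_{i,s} in x^i\<close>
    and D_prob: "\<And>i. i < n \<Longrightarrow> prob_space (D i)"
    and D_sets: "\<And>i. i < n \<Longrightarrow> sets (D i) = sets S"
    and fs_int: "\<And>i x. i < n \<Longrightarrow> integrable (D i) (\<lambda>s. fs i s x)"
    and f_exp: "\<And>i x. i < n \<Longrightarrow> f i x = (\<integral>s. fs i s x \<partial>D i)"
    and gs_block: "\<And>i s x. i < n \<Longrightarrow> s \<in> space S \<Longrightarrow> gs i s x \<in> span (B i)"
    and gs_grad: "\<And>i s x. i < n \<Longrightarrow> s \<in> space S \<Longrightarrow>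
       ((\<lambda>y. fs i s (with_block (B i) x y)) has_derivative (\<lambda>h. gs i s x \<bullet> h))
         (at (blkproj (B i) x) within span (B i))"
    and gs_meas: "\<And>i. i < n \<Longrightarrow> (\<lambda>(s, x). gs i s x) \<in> borel_measurable (S \<Otimes>\<^sub>M borel)"
    and gs_int: "\<And>i x. i < n \<Longrightarrow> integrable (D i) (\<lambda>s. gs i s x)"
    and unbiased: "\<And>i x. i < n \<Longrightarrow> (\<integral>s. gs i s x \<partial>D i) = G i x"
    \<comment> \<open>(CVX)\<close>
    and CVX: "\<And>i x. i < n \<Longrightarrow> convex_on (span (B i)) (\<lambda>y. f i (with_block (B i) x y))"
    \<comment> \<open>(SM)\<close>
    and SM: "\<And>i x y y'. i < n \<Longrightarrow> y \<in> span (B i) \<Longrightarrow> y' \<in> span (B i) \<Longrightarrow>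
       norm (G i (with_block (B i) x y) - G i (with_block (B i) x y')) \<le> L i * norm (y - y')"
    \<comment> \<open>(BV)\<close>
    and BV: "\<And>i x. i < n \<Longrightarrow>
       (\<integral>\<^sup>+ s. ennreal ((norm (gs i s x - G i x))\<^sup>2) \<partial>D i) \<le> ennreal ((\<sigma> i)\<^sup>2)"
    \<comment> \<open>(QSM)\<close>
    and mu_pos: "\<mu> > 0"
    and xs_zero: "(\<Sum>i<n. G i xs) = 0"
    and xs_unique: "\<And>x. (\<Sum>i<n. G i x) = 0 \<Longrightarrow> x = xs"
    and QSM: "\<And>x. (\<Sum>i<n. G i x) \<bullet> (x - xs) \<ge> \<mu> * (norm (x - xs))\<^sup>2"
    \<comment> \<open>(SCO)\<close>
    and ell_pos: "ell > 0"
    and SCO: "\<And>x. (\<Sum>i<n. G i x) \<bullet> (x - xs) \<ge> (1 / ell) * (norm (\<Sum>i<n. G i x))\<^sup>2"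
    \<comment> \<open>random samples: xi i k ~ D i, all mutually independent\<close>
    and M_prob: "prob_space M"
    and xi_indep: "prob_space.indep_vars M (\<lambda>_. S) (\<lambda>(i, k). \<xi> i k) ({..<n} \<times> {..<\<tau> * R})"
    and xi_distr: "\<And>i k. i < n \<Longrightarrow> k < \<tau> * R \<Longrightarrow> distr M S (\<xi> i k) = D i"
    \<comment> \<open>parameters and step sizes\<close>
    and tau: "\<tau> \<ge> 1" and R: "R \<ge> 1"
    and step: "\<And>k. k < \<tau> * R \<Longrightarrow>
       \<gamma> k = (let Lmax = Max (L ` {..<n}); \<kappa> = ell / \<mu>; q = Lmax / sqrt (ell * \<mu>);
                  p = real (k div \<tau>)
              in if p < 2 * (1 + 2 * q) * \<kappa> then 1 / (ell * real \<tau> * (1 + 2 * q))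
                 else 1 / (real \<tau> * \<mu>) * ((2 * p + 1) / (p + 1)\<^sup>2))"
  shows "(let Lmax = Max (L ` {..<n}); \<kappa> = ell / \<mu>; q = Lmax / sqrt (ell * \<mu>);
             \<sigma>2 = (\<Sum>i<n. (\<sigma> i)\<^sup>2); T = real (\<tau> * R); t = real \<tau>
         in (\<integral>\<^sup>+ \<omega>. ennreal ((norm (pearl_iter n B gs \<gamma> \<tau> (\<lambda>i k. \<xi> i k \<omega>) x0 (\<tau> * R) - xs))\<^sup>2) \<partial>M)
            \<le> ennreal (4 * (1 + 2 * q)\<^sup>2 * \<kappa>\<^sup>2 * t\<^sup>2 * (norm (x0 - xs))\<^sup>2 / (exp 1 * T\<^sup>2)
                 + 4 * (1 + q) * \<sigma>2 / (\<mu>\<^sup>2 * T)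
                 + 4 * (1 + 2 * q)\<^sup>2 * \<kappa> * t * \<sigma>2 / (\<mu>\<^sup>2 * T\<^sup>2) * (1 + 2 * t / sqrt \<kappa>)
                 + 32 * (1 + q) * t\<^sup>2 * Lmax * \<sigma>2 * ln T / (\<mu> ^ 3 * T\<^sup>2)))"
proof -
  define Lmax \<kappa> q \<sigma>2 where "Lmax = Max (L ` {..<n})" and "\<kappa> = ell / \<mu>"
    and "q = Lmax / sqrt (ell * \<mu>)" and "\<sigma>2 = (\<Sum>i<n. (\<sigma> i)\<^sup>2)"
  \<comment> \<open>\<open>\<alpha>\<close> is \<open>\<tau> * \<gamma> * \<mu>\<close> in the
    constant phase, which makes the switching threshold \<open>2 / \<alpha>\<close>;
    \<open>V\<close> is scaled so that the noise of round \<open>p\<close> is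
    \<open>V * (\<beta> p)\<^sup>2\<close>.\<close>
  define \<alpha> V where "\<alpha> = 1 / ((1 + 2 * q) * \<kappa>)" and "V = (1 + q) * \<sigma>2 / (real \<tau> * \<mu>\<^sup>2)"
  define \<beta> where "\<beta> p = (if real p < 2 / \<alpha> then \<alpha> else (2 * real p + 1) / (real p + 1)\<^sup>2)" for p
  interpret basis_blocks n B
    using blocks_sub blocks_disj blocks_cover by unfold_locales
  interpret prob_space M by (rule M_prob)
  have L_le: "L i \<le> Lmax" if "i < n" for i
    unfolding Lmax_def using that by (intro Max_ge) auto
  \<comment> \<open>The sign follows from SM for a unit basis vector and 0 in the block that
    contains it.\<close>
  have Lmax0: "0 \<le> Lmax"
  proof -
    obtain b :: 'a where b: "b \<in> Basis" using nonempty_Basis by blast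
    then obtain i where i: "i < n" "b \<in> B i" using blocks_cover by blast
    have "0 \<le> L i * norm (b - 0)"
      by (rule order_trans[OF norm_ge_zero SM[OF i(1) span_base[OF i(2)] span_zero]])
    with b L_le[OF i(1)] show ?thesis by simp
  qed
  have sqrt_pos: "0 < sqrt (ell * \<mu>)" using mu_pos ell_pos by simp
  have q0: "0 \<le> q" and Lq: "Lmax = q * sqrt (ell * \<mu>)"
    using Lmax0 sqrt_pos mu_pos ell_pos by (simp_all add: q_def)
  have SM': "norm (G i (with_block (B i) x y) - G i (with_block (B i) x y')) \<le> Lmax * norm (y - y')"
    if "i < n" "y \<in> span (B i)" "y' \<in> span (B i)" for i x y y'
    by (rule order_trans[OF SM[OF that] mult_right_mono[OF L_le[OF that(1)]]]) simp
  have coco: "(norm (local_field n B G a x - local_field n B G a y))\<^sup>2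
      \<le> Lmax * ((local_field n B G a x - local_field n B G a y) \<bullet> (x - y))" for a x y
    by (rule local_field_cocoercive[OF G_block G_grad CVX SM' Lmax0])
  interpret pearl_sgd n B M G S D gs \<sigma> Lmax q \<mu> ell xs x0 \<xi> \<tau> "\<tau> * R" \<gamma>
    by (intro pearl_sgd.intro pearl_sgd_axioms.intro basis_blocks_axioms prob_space_axioms)
      (fact G_block D_prob D_sets gs_block gs_meas gs_int unbiased BV coco Lmax0 q0 Lq mu_pos ell_pos
        QSM SCO xi_indep xi_distr tau)+
  have \<kappa>: "1 \<le> \<kappa>" using mu_le_ell mu_pos by (simp add: \<kappa>_def)
  have \<alpha>: "0 < \<alpha>" "\<alpha> \<le> 1"
  proof -
    have "1 * 1 \<le> (1 + 2 * q) * \<kappa>" using q0 \<kappa> by (intro mult_mono) auto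
    then show "0 < \<alpha>" "\<alpha> \<le> 1" by (simp_all add: \<alpha>_def)
  qed
  have \<sigma>2: "0 \<le> \<sigma>2" by (simp add: \<sigma>2_def sum_nonneg)
  have V0: "0 \<le> V" using q0 \<sigma>2 by (simp add: V_def)
  have t0: "0 < real \<tau>" and R0: "0 < real R" using tau R by simp_all
  have \<beta>: "0 < \<beta> p" "\<beta> p \<le> \<alpha>" for p
  proof -
    show "0 < \<beta> p" using \<alpha> by (simp add: \<beta>_def)
    \<comment> \<open>The decreasing steps never exceed the constant one, so the step size condition
      of a round holds in both phases. After the switch \<open>\<alpha> * p \<ge> 2\<close>.\<close>
    show "\<beta> p \<le> \<alpha>"
    proof (cases "real p < 2 / \<alpha>")
      case False
      then have p: "2 \<le> \<alpha> * real p" using \<alpha> by (simp add: field_simps)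
      have "2 * real p + 1 \<le> 2 * (real p + 1)" by simp
      also have "\<dots> \<le> (\<alpha> * (real p + 1)) * (real p + 1)"
        using p \<alpha> by (intro mult_right_mono) (auto simp: distrib_left)
      finally have "(2 * real p + 1) / (real p + 1)\<^sup>2 \<le> \<alpha>"
        by (simp add: pos_divide_le_eq power2_eq_square mult.assoc)
      with False show ?thesis by (simp add: \<beta>_def)
    qed (simp add: \<beta>_def)
  qed
  \<comment> \<open>The real sequence satisfying the round recursion with equality; it majorises the
    expected errors.\<close>
  define E where "E = rec_nat ((norm (x0 - xs))\<^sup>2) (\<lambda>p e. (1 - \<beta> p) * e + V * (\<beta> p)\<^sup>2)"
  have E0: "E 0 = (norm (x0 - xs))\<^sup>2" and E_Suc: "E (Suc p) = (1 - \<beta> p) * E p + V * (\<beta> p)\<^sup>2" for p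
    by (simp_all add: E_def)
  have E_nonneg: "0 \<le> E p" for p
  proof (induction p)
    case (Suc p)
    then show ?case using \<beta>[of p] \<alpha> V0 by (simp add: E_Suc)
  qed (simp add: E0)
  have step': "\<gamma> (\<tau> * p + m) = \<beta> p / (real \<tau> * \<mu>)" if "p < R" "m < \<tau>" for p m
  proof -
    have "\<tau> * p + m < \<tau> * Suc p" using that by simp
    also have "\<dots> \<le> \<tau> * R" using that by (intro mult_le_mono) auto
    finally have k: "\<tau> * p + m < \<tau> * R" .
    have div: "(\<tau> * p + m) div \<tau> = p" using that by simp
    have "2 / \<alpha> = 2 * (1 + 2 * q) * \<kappa>" by (simp add: \<alpha>_def)
    moreover have "1 / (ell * real \<tau> * (1 + 2 * q)) = \<alpha> / (real \<tau> * \<mu>)"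
      using mu_pos by (simp add: \<alpha>_def \<kappa>_def)
    ultimately show ?thesis
      using step[OF k] unfolding div Let_def Lmax_def[symmetric] q_def[symmetric] \<kappa>_def[symmetric]
      by (simp add: \<beta>_def)
  qed
  have bound: "(\<integral>\<^sup>+ \<omega>. ennreal ((norm (anchor p \<omega> - xs))\<^sup>2) \<partial>M) \<le> ennreal (E p)" if "p \<le> R" for p
    using that
  proof (induction p)
    case 0
    then show ?case by (simp add: E0 emeasure_space_1)
  next
    case (Suc p)
    define \<eta> where "\<eta> = \<beta> p / (real \<tau> * \<mu>)"
    have \<eta>: "0 < \<eta>" using \<beta>[of p] t0 mu_pos by (simp add: \<eta>_def)
    have c\<mu>: "real \<tau> * \<eta> * \<mu> = \<beta> p" using t0 mu_pos by (simp add: \<eta>_def)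
    have c: "real \<tau> * \<eta> * (ell * (1 + 2 * q)) \<le> 1"
    proof -
      have "real \<tau> * \<eta> * (ell * (1 + 2 * q)) = \<beta> p / \<alpha>"
        using t0 mu_pos by (simp add: \<eta>_def \<alpha>_def \<kappa>_def)
      also have "\<dots> \<le> 1" using \<beta>[of p] \<alpha> by simp
      finally show ?thesis .
    qed
    have noise: "real \<tau> * ((1 + q) * \<eta>\<^sup>2 * \<sigma>2) = V * (\<beta> p)\<^sup>2"
      using t0 mu_pos by (simp add: \<eta>_def V_def power2_eq_square mult_ac)
    have "\<tau> * Suc p \<le> \<tau> * R" using Suc.prems by (intro mult_le_mono) auto
    from expected_round_le[OF \<eta> c this] step'[of p] Suc.prems
    have "(\<integral>\<^sup>+ \<omega>. ennreal ((norm (anchor (Suc p) \<omega> - xs))\<^sup>2) \<partial>M)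
        \<le> ennreal (1 - \<beta> p) * (\<integral>\<^sup>+ \<omega>. ennreal ((norm (anchor p \<omega> - xs))\<^sup>2) \<partial>M) + ennreal (V * (\<beta> p)\<^sup>2)"
      by (simp add: c\<mu> noise \<eta>_def[symmetric] \<sigma>2_def[symmetric])
    also have "\<dots> \<le> ennreal (1 - \<beta> p) * ennreal (E p) + ennreal (V * (\<beta> p)\<^sup>2)"
      using Suc by (intro add_right_mono mult_left_mono) auto
    also have "\<dots> = ennreal (E (Suc p))"
      using E_nonneg[of p] \<beta>[of p] \<alpha> V0 by (simp add: E_Suc flip: ennreal_plus ennreal_mult)
    finally show ?case .
  qed
  have rate: "(real R)\<^sup>2 * E R \<le> 4 / (exp 1 * \<alpha>\<^sup>2) * E 0 + V * (2 + \<alpha>)\<^sup>2 / \<alpha> + 4 * real R * V"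
    by (rule two_phase_recursion_le[OF \<alpha> V0 E_nonneg E_Suc[unfolded \<beta>_def]])
  define T where "T = real (\<tau> * R)"
  have T: "T = real \<tau> * real R" by (simp add: T_def)
  let ?b1 = "4 * (1 + 2 * q)\<^sup>2 * \<kappa>\<^sup>2 * (real \<tau>)\<^sup>2 * (norm (x0 - xs))\<^sup>2 / (exp 1 * T\<^sup>2)"
    and ?b2 = "4 * (1 + q) * \<sigma>2 / (\<mu>\<^sup>2 * T)"
    and ?b3 = "4 * (1 + 2 * q)\<^sup>2 * \<kappa> * real \<tau> * \<sigma>2 / (\<mu>\<^sup>2 * T\<^sup>2) * (1 + 2 * real \<tau> / sqrt \<kappa>)"
    and ?b4 = "32 * (1 + q) * (real \<tau>)\<^sup>2 * Lmax * \<sigma>2 * ln T / (\<mu> ^ 3 * T\<^sup>2)"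
  have b1: "4 / (exp 1 * \<alpha>\<^sup>2) * E 0 / (real R)\<^sup>2 = ?b1"
    using t0 R0 by (simp add: E0 T \<alpha>_def power_mult_distrib power_divide mult_ac)
  have b2: "4 * real R * V / (real R)\<^sup>2 = ?b2"
    using t0 R0 mu_pos by (simp add: T V_def power2_eq_square mult_ac)
  \<comment> \<open>The goal reduces to \<open>key\<close>. There \<open>\<alpha> \<le> 1\<close>
    gives \<open>(2 + \<alpha>)\<^sup>2 \<le> 4 + 5 * \<alpha>\<close>, and
    \<open>\<alpha> * (1 + q) \<le> 1 / sqrt \<kappa>\<close> puts the \<open>\<alpha>\<close> part
    into the term with \<open>sqrt \<kappa>\<close>, where 5 is rounded up to 8.\<close>
  have b3: "V * (2 + \<alpha>)\<^sup>2 / \<alpha> / (real R)\<^sup>2 \<le> ?b3"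
  proof -
    have sk: "1 \<le> sqrt \<kappa>" "sqrt \<kappa> \<le> \<kappa>"
      using \<kappa> by (auto intro!: real_le_lsqrt simp: power2_eq_square)
    have \<alpha>q: "\<alpha> * (1 + q) \<le> 1 / sqrt \<kappa>"
    proof -
      have "\<alpha> * (1 + q) = 1 / \<kappa> * ((1 + q) / (1 + 2 * q))" by (simp add: \<alpha>_def)
      also have "\<dots> \<le> 1 / sqrt \<kappa> * 1"
        using q0 sk by (intro mult_mono divide_left_mono) auto
      finally show ?thesis by simp
    qed
    have "\<alpha>\<^sup>2 \<le> \<alpha>" using \<alpha> by (simp add: power2_eq_square mult_left_le)
    then have "(2 + \<alpha>)\<^sup>2 \<le> 4 + 5 * \<alpha>" by (simp add: power2_eq_square algebra_simps)
    then have "(1 + q) * (2 + \<alpha>)\<^sup>2 \<le> (1 + q) * (4 + 5 * \<alpha>)"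
      using q0 by (intro mult_left_mono) auto
    also have "\<dots> = 4 * (1 + q) + 5 * (\<alpha> * (1 + q))" by (simp add: algebra_simps)
    also have "\<dots> \<le> 4 * (1 + 2 * q) + 8 * (1 / sqrt \<kappa>)"
      using \<alpha>q q0 sk by (intro add_mono) (auto intro: order_trans[of _ "5 * (1 / sqrt \<kappa>)"] simp: divide_right_mono)
    also have "8 * (1 / sqrt \<kappa>) \<le> 4 * (1 + 2 * q) * (2 * real \<tau> / sqrt \<kappa>)"
    proof -
      have "4 * 2 \<le> 4 * (1 + 2 * q) * (2 * real \<tau>)"
        using q0 tau by (intro mult_mono) auto
      from divide_right_mono[OF this, of "sqrt \<kappa>"] show ?thesis using sk by simp
    qed
    finally have key: "(1 + q) * (2 + \<alpha>)\<^sup>2 \<le> 4 * (1 + 2 * q) * (1 + 2 * real \<tau> / sqrt \<kappa>)"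
      by (simp add: distrib_left)
    have "V * (2 + \<alpha>)\<^sup>2 / \<alpha> / (real R)\<^sup>2
        = (\<sigma>2 * (1 + 2 * q) * \<kappa> / (real \<tau> * \<mu>\<^sup>2 * (real R)\<^sup>2)) * ((1 + q) * (2 + \<alpha>)\<^sup>2)"
      by (simp add: V_def \<alpha>_def mult_ac)
    also have "\<dots> \<le> (\<sigma>2 * (1 + 2 * q) * \<kappa> / (real \<tau> * \<mu>\<^sup>2 * (real R)\<^sup>2))
        * (4 * (1 + 2 * q) * (1 + 2 * real \<tau> / sqrt \<kappa>))"
      using \<sigma>2 q0 \<kappa> by (intro mult_left_mono key) auto
    also have "\<dots> = ?b3"
      using t0 R0 mu_pos by (simp add: T power2_eq_square mult_ac)
    finally show ?thesis .
  qed
  have b4: "0 \<le> ?b4"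
  proof -
    \<comment> \<open>This makes \<open>ln T\<close> nonnegative.\<close>
    have "1 * 1 \<le> T" unfolding T using tau R by (intro mult_mono) auto
    then show ?thesis using q0 Lmax0 \<sigma>2 mu_pos by simp
  qed
  have "E R \<le> (4 / (exp 1 * \<alpha>\<^sup>2) * E 0 + V * (2 + \<alpha>)\<^sup>2 / \<alpha> + 4 * real R * V) / (real R)\<^sup>2"
    using rate R0 by (simp add: pos_le_divide_eq mult.commute)
  also have "\<dots> = ?b1 + V * (2 + \<alpha>)\<^sup>2 / \<alpha> / (real R)\<^sup>2 + ?b2"
    by (simp only: add_divide_distrib b1 b2)
  also have "\<dots> \<le> ?b1 + ?b2 + ?b3 + ?b4" using b3 b4 by linarith
  finally have "ennreal (E R) \<le> ennreal (?b1 + ?b2 + ?b3 + ?b4)" by (rule ennreal_leI)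
  \<comment> \<open>Index \<open>\<tau> * R\<close> has quotient \<open>R\<close> and remainder 0,
    so the final iterate is the anchor after \<open>R\<close> full rounds, before any local step of
    round \<open>R\<close>.\<close>
  moreover have "pearl_iter n B gs \<gamma> \<tau> (\<lambda>i k. \<xi> i k \<omega>) x0 (\<tau> * R) = anchor R \<omega>" for \<omega>
    using tau by (simp add: pearl_iter_def)
  ultimately show ?thesis
    using order_trans[OF bound[OF order_refl]]
    unfolding Let_def Lmax_def[symmetric] \<kappa>_def[symmetric] q_def[symmetric] \<sigma>2_def[symmetric] T_def[symmetric]
    by simp
qed

end
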